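(* Let $n\ge 2$ be an integer, and let $\tau>0$, $0<m_\alpha\le M_\alpha$ and $0<a<\min(1/6,\tau)$ be real constants. There exist positive constants $C_0,c_0,C_1,C$, depending only on $n,\tau,m_\alpha,M_\alpha,a$, such that the following holds. Let $\Omega>0$, let $x_1,\dots,x_n\in[-\tfrac12,\tfrac12]$ be distinct nodes with minimal separation $\Delta:=\min_{s\ne k}|x_s-x_k|$, and let $\alpha_1,\dots,\alpha_n\in\mathbb{C}$ be amplitudes. Assume: 1. (single cluster containing all $n$ nodes) $|x_s-x_k|\le 2\tau\Delta$ for all $s,k$; 2. $m_\alpha\le|\alpha_k|\le M_\alpha$ for all $k$; 3. the super-resolution factor $\mathrm{SRF}:=\frac{1}{\Omega\Delta}$ satisfies $\mathrm{SRF}\ge C_0$; 4. $0<\epsilon\le c_0(\Omega\Delta)^{2n-1}$; 5. (genericity) when $[-\tfrac12,\tfrac12]$ is divided into $N_b=\lceil 3\Delta^{-1}\rceil$ equal bins, the distance from each $x_j$ to the closest bin edge is at least $a\Delta$. Let $g(\omega)=\sum_{k=1}^n\alpha_k e^{2\pi \mathrm{j}x_k\omega}+e(\omega)$ for $\omega\in[-\Omega,\Omega]$, where $e:[-\Omega,\Omega]\to\mathbb{C}$ is any function with $\|e\|_\infty\le\epsilon$. Then the Decimated Prony Method (defined in the context), run on $g$ with parameters $n$, $\Omega$, $N_\lambda=\lceil C_1\Omega\rceil$ and $N_b=\lceil 3\Delta^{-1}\rceil$, succeeds (i.e. its set $\Lambda$ is nonempty), and its output $\{\tilde x_j,\tilde\alpha_j\}_{j=1}^n$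 satisfies, after a suitable reordering of the indices, $$|x_j-\tilde x_j|\le C\,\mathrm{SRF}^{2n-2}\,\frac{\epsilon}{\Omega},\qquad |\alpha_j-\tilde\alpha_j|\le C\,\mathrm{SRF}^{2n-1}\,\epsilon,\qquad j=1,\dots,n.$$
   Context: Here $\mathrm{j}$ in exponents denotes the imaginary unit, while $j$ as an index is an integer. $\operatorname{Arg}$ is the principal argument, and $\operatorname{col}\{y_k\}_{k=1}^m$ is the column vector with entries $y_1,\dots,y_m$. Whenever a least squares minimizer is not unique, any minimizer may be used; roots are counted with multiplicity. **Classical Prony method.** Input: a sequence $\{\tilde m_k\}_{k=0}^{2n-1}\subset\mathbb{C}$. (i) Form the Hankel matrix $\tilde H_n=(\tilde m_{i+j})_{0\le i,j\le n-1}$. (ii) Compute $\operatorname{col}\{q_k\}_{k=0}^{n-1}\in\arg\min_{\mathbf q\in\mathbb{C}^n}\|\tilde H_n\mathbf q+\operatorname{col}\{\tilde m_k\}_{k=n}^{2n-1}\|_2$. (iii) Let $\tilde z_1,\dots,\tilde z_n$ be the roots of $q(z)=z^n+\sum_{i=0}^{n-1}q_iz^i$. (iv) Output the node estimates $\tilde y_k=\operatorname{Arg}(\tilde z_k)/(2\pi)$, $k=1,\dots,n$. (The method also outputs amplitude estimates given by a minimizer of $\|\tilde V\boldsymbol\alpha-\operatorname{col}\{\tilde m_k\}_{k=0}^{n-1}\|_2$ over $\boldsymbol\alpha\in\mathbb{C}^n$, with $\tilde V=(\tilde z_k^i)_{i=0,\dots,n-1}^{k=1,\dots,n}$ having row index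 $i$ and column index $k$; these are not used below.) **Decimated Prony Method (DPM).** Parameters: $n,\Omega$ and positive integers $N_\lambda,N_b$. Input: the function $g$ on $[-\Omega,\Omega]$. 1. Let $\mathcal J=\left[\frac12\frac{\Omega}{2n-1},\frac{\Omega}{2n-1}\right]$ and let $G\subset\mathcal J$ be the uniform (equispaced) grid of $N_\lambda$ points in $\mathcal J$. 2. For each $\lambda\in G$, put $\tilde m^{(\lambda)}_k=g(\lambda k)$ for $k=0,\dots,2n-1$, apply the classical Prony method to $\{\tilde m^{(\lambda)}_k\}_{k=0}^{2n-1}$ to get node estimates $\tilde y_{\lambda,1},\dots,\tilde y_{\lambda,n}$, and form the set of aliased solutions $$X_\lambda=\bigcup_{j=1}^n\left\{(\lambda,t):\ t=\frac{\tilde y_{\lambda,j}+m}{\lambda},\ m\in\mathbb{Z},\ |t|\le\tfrac12\right\}.$$ 3. Compute the histogram of $\{x:(\lambda,x)\in\bigcup_{\lambda\in G}X_\lambda\}$ (counted over all pairs $(\lambda,x)$) using $N_b$ equal bins partitioning $[-\tfrac12,\tfrac12]$, and let $B_1,\dots,B_n$ be the $n$ bins with the largest counts. 4. Let $\Lambda=\bigcap_{k=1}^n\{\lambda\in G:\ \text{there is } x\in B_k\text{ with }(\lambda,x)\in X_\lambda\}$. If $\Lambda=\emptyset$ the algorithm fails; otherwise set $\lambda^*=\max\Lambda$. 5. For each $j=1,\dots,n$ choose $\tilde x_j\in B_j$ with $(\lambda^*,\tilde x_j)\in X_{\lambda^*}$. 6. Let $\tilde V=(e^{2\pi\mathrm{j}\tilde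 x_jk\lambda^*})_{k=0,\dots,n-1}^{j=1,\dots,n}$ (row index $k$, column index $j$) and let $\operatorname{col}\{\tilde\alpha_k\}_{k=1}^n\in\arg\min_{\boldsymbol\alpha\in\mathbb{C}^n}\|\tilde V\boldsymbol\alpha-\operatorname{col}\{\tilde m^{(\lambda^* )}_k\}_{k=0}^{n-1}\|_2$. 7. Return $\{\tilde x_j,\tilde\alpha_j\}_{j=1}^n$. *)

theory Defs
  imports
    "HOL-Analysis.Analysis"
    "HOL-Computational_Algebra.Polynomial"
    "HOL-Combinatorics.Permutations"
    "Jordan_Normal_Form.Matrix"
begin

unbundle no vec_syntax

section \<open>Complex least squares\<close>

definition cvec_norm :: "complex vec \<Rightarrow> real" where
  "cvec_norm v = L2_set (\<lambda>i. cmod (v $ i)) {..<dim_vec v}"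

definition least_squares_solution :: "complex mat \<Rightarrow> complex vec \<Rightarrow> complex vec \<Rightarrow> bool" where
  "least_squares_solution A b u \<longleftrightarrow>
     is_arg_min (\<lambda>v. cvec_norm (A *\<^sub>v v - b)) (\<lambda>v. v \<in> carrier_vec (dim_col A)) u"


section \<open>The classical Prony method\<close>

definition hankel :: "nat \<Rightarrow> (nat \<Rightarrow> complex) \<Rightarrow> complex mat" where
  "hankel n m = mat n n (\<lambda>(i, j). m (i + j))"

definition monic_poly :: "nat \<Rightarrow> complex vec \<Rightarrow> complex poly" where
  "monic_poly n q = monom 1 n + (\<Sum>i<n. monom (q $ i) i)"

text \<open>
  \<open>prony_nodes n m y\<close> says that \<open>y 0, \<dots>, y (n - 1)\<close> is a possible list of node estimates
  for the data \<open>m 0, \<dots>, m (2 * n - 1)\<close>.  It is a relation because neither the minimizer \<open>q\<close>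
  nor the order of the roots is unique.
\<close>

definition prony_nodes :: "nat \<Rightarrow> (nat \<Rightarrow> complex) \<Rightarrow> (nat \<Rightarrow> real) \<Rightarrow> bool" where
  "prony_nodes n m y \<longleftrightarrow>
     (\<exists>q z. least_squares_solution (hankel n m) (- vec n (\<lambda>k. m (n + k))) q \<and>
            monic_poly n q = (\<Prod>k<n. [:- z k, 1:]) \<and>
            (\<forall>k<n. y k = Arg (z k) / (2 * pi)))"


section \<open>The Decimated Prony Method\<close>

text \<open>
  Equispaced grid on \<open>[\<Omega> / (2 * (2 * n - 1)), \<Omega> / (2 * n - 1)]\<close> with both endpoints included.  For
  \<open>N = 1\<close> the quotient by \<open>real N - 1 = 0\<close> is \<open>0\<close>, so the grid is the left endpoint.
\<close>

definition dpm_grid :: "nat \<Rightarrow> real \<Rightarrow> nat \<Rightarrow> real set" where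
  "dpm_grid n \<Omega> N =
     (let lo = 1 / 2 * (\<Omega> / (2 * real n - 1)); hi = \<Omega> / (2 * real n - 1)
      in (\<lambda>i. lo + real i * ((hi - lo) / (real N - 1))) ` {..<N})"

definition aliased_solutions :: "nat \<Rightarrow> real \<Rightarrow> (nat \<Rightarrow> real) \<Rightarrow> (real \<times> real) set" where
  "aliased_solutions n l y =
     (\<Union>j<n. {(l, t) | t. \<exists>m::int. t = (y j + of_int m) / l \<and> \<bar>t\<bar> \<le> 1 / 2})"

definition bin_edge :: "nat \<Rightarrow> nat \<Rightarrow> real" where
  "bin_edge N i = - 1 / 2 + real i / real N"

text \<open>
  The \<open>N\<close> equal bins of \<open>[- 1 / 2, 1 / 2]\<close>, indexed by \<open>i < N\<close>.  As usual for histograms they are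
  closed on the left and open on the right, except for the last one, which is closed.
\<close>

definition hist_bin :: "nat \<Rightarrow> nat \<Rightarrow> real set" where
  "hist_bin N i =
     (if Suc i = N then {bin_edge N i .. bin_edge N (Suc i)}
      else {bin_edge N i ..< bin_edge N (Suc i)})"

definition hist_count :: "(real \<times> real) set \<Rightarrow> nat \<Rightarrow> nat \<Rightarrow> nat" where
  "hist_count S N i = card {p \<in> S. snd p \<in> hist_bin N i}"

text \<open>\<open>B 0, \<dots>, B (n - 1)\<close> are the indices of \<open>n\<close> bins with the largest counts, ties broken arbitrarily.\<close>

definition largest_bins :: "nat \<Rightarrow> nat \<Rightarrow> (nat \<Rightarrow> nat) \<Rightarrow> (nat \<Rightarrow> nat) \<Rightarrow> bool" where
  "largest_bins n N cnt B \<longleftrightarrow>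
     inj_on B {..<n} \<and> B ` {..<n} \<subseteq> {..<N} \<and>
     (\<forall>k<n. \<forall>i \<in> {..<N} - B ` {..<n}. cnt i \<le> cnt (B k))"

text \<open>
  The choices left open by the algorithm are made explicit: \<open>Y l\<close> is the list of node estimates
  returned by the Prony method for the decimation parameter \<open>l\<close>, and \<open>B\<close> the selection of bins.  The same \<open>Y\<close> and \<open>B\<close>
  are used in all later steps.
\<close>

definition dpm_choices ::
  "nat \<Rightarrow> real \<Rightarrow> nat \<Rightarrow> nat \<Rightarrow> (real \<Rightarrow> complex) \<Rightarrow> (real \<Rightarrow> nat \<Rightarrow> real) \<Rightarrow> (nat \<Rightarrow> nat) \<Rightarrow> bool"
where
  "dpm_choices n \<Omega> N\<^sub>l N\<^sub>b g Y B \<longleftrightarrow>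
     (\<forall>l \<in> dpm_grid n \<Omega> N\<^sub>l. prony_nodes n (\<lambda>k. g (l * real k)) (Y l)) \<and>
     largest_bins n N\<^sub>b
       (hist_count (\<Union>l \<in> dpm_grid n \<Omega> N\<^sub>l. aliased_solutions n l (Y l)) N\<^sub>b) B"

definition dpm_Lambda ::
  "nat \<Rightarrow> real \<Rightarrow> nat \<Rightarrow> nat \<Rightarrow> (real \<Rightarrow> nat \<Rightarrow> real) \<Rightarrow> (nat \<Rightarrow> nat) \<Rightarrow> real set"
where
  "dpm_Lambda n \<Omega> N\<^sub>l N\<^sub>b Y B =
     (\<Inter>k<n. {l \<in> dpm_grid n \<Omega> N\<^sub>l.
               \<exists>x \<in> hist_bin N\<^sub>b (B k). (l, x) \<in> aliased_solutions n l (Y l)})"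

definition dpm_output ::
  "nat \<Rightarrow> real \<Rightarrow> nat \<Rightarrow> nat \<Rightarrow> (real \<Rightarrow> complex) \<Rightarrow> (real \<Rightarrow> nat \<Rightarrow> real) \<Rightarrow> (nat \<Rightarrow> nat) \<Rightarrow>
   (nat \<Rightarrow> real) \<Rightarrow> complex vec \<Rightarrow> bool"
where
  "dpm_output n \<Omega> N\<^sub>l N\<^sub>b g Y B x' \<alpha>' \<longleftrightarrow>
     dpm_Lambda n \<Omega> N\<^sub>l N\<^sub>b Y B \<noteq> {} \<and>
     (let l = Max (dpm_Lambda n \<Omega> N\<^sub>l N\<^sub>b Y B) in
        (\<forall>j<n. x' j \<in> hist_bin N\<^sub>b (B j) \<and> (l, x' j) \<in> aliased_solutions n l (Y l)) \<and>
        least_squares_solution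
          (mat n n (\<lambda>(k, j). exp (2 * of_real pi * \<i> * of_real (x' j) * of_nat k * of_real l)))
          (vec n (\<lambda>k. g (l * real k))) \<alpha>')"


section \<open>Node configurations\<close>

definition min_separation :: "nat \<Rightarrow> (nat \<Rightarrow> real) \<Rightarrow> real" where
  "min_separation n x = Min {\<bar>x s - x k\<bar> | s k. s < n \<and> k < n \<and> s \<noteq> k}"

definition srf :: "real \<Rightarrow> real \<Rightarrow> real" where
  "srf \<Omega> \<Delta> = 1 / (\<Omega> * \<Delta>)"

end

theory Submission
  imports Defs "Jordan_Normal_Form.Determinant"
begin

text \<open>
  Fix a grid parameter \<open>l\<close>.  The samples \<open>g (l * k)\<close> are those of an exponential sum with nodes
  \<open>z j = cis (2 * pi * x j * l)\<close> on the unit circle.  Since \<open>l\<close> is of order \<open>\<Omega>\<close>, the separation \<open>s\<close> of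
  these nodes is of order \<open>\<Omega> * \<Delta> = 1 / SRF\<close>, and there is no wrap-around because the whole cluster
  covers a short arc.

  The Prony polynomial \<open>q\<close> satisfies \<open>n\<close> linear recurrences on the samples.  Combining them with the
  coefficients of the Lagrange polynomial of \<open>z j\<close>, which are of order \<open>s ^ - (n - 1)\<close>, isolates the
  value of \<open>q\<close> at \<open>z j\<close> and bounds it by \<open>\<epsilon> * s ^ - (n - 1)\<close> up to a constant
  (\<open>annihilator_small_at_nodes\<close>).  If \<open>\<epsilon>\<close> is a small multiple of \<open>s ^ (2 * n - 1)\<close>, then this is below
  \<open>(s / 4) ^ n\<close>; so each node has a root of \<open>q\<close> nearby, the other roots are at distance at least
  \<open>s / 2\<close>, and division gives a root error of order \<open>\<epsilon> * s ^ - (2 * n - 2)\<close>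
  (\<open>roots_near_nodes\<close>, \<open>prony_roots_error\<close>).  Division of the angle by \<open>2 * pi * l\<close> turns it into the
  stated node error, up to a multiple of the alias period \<open>1 / l\<close>.

  It remains to see that the histogram finds the right multiples.  Every \<open>l\<close> contributes one candidate
  to the bin of each node and at most one to any other bin.  A bin without a node can only be hit by a
  candidate near \<open>x j + m / l\<close> with \<open>m\<close> not zero; for given \<open>j\<close> and \<open>m\<close> this confines \<open>l\<close> to a short
  interval, and counting shows that these intervals do not exhaust the grid
  (\<open>grid_avoids_aliases\<close>).  So the bins of the nodes have strictly larger counts than all
  others (\<open>dpm_selects_true_bins\<close>), all grid parameters belong to \<open>\<Lambda>\<close>, and whichever of them is
  the maximum, the selected candidates are the ones near the nodes.

  The amplitudes solve a Vandermonde system for the estimated nodes.  Inverting it with Lagrange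
  polynomials and comparing their values at the true and at the estimated nodes costs one more factor
  \<open>1 / s\<close>, because all nodes lie within a distance comparable with \<open>s\<close> (\<open>amplitude_error\<close>).
\<close>

section \<open>Least squares problems with a unique solution\<close>

lemma cvec_norm_eq_0_iff: "cvec_norm v = 0 \<longleftrightarrow> v = 0\<^sub>v (dim_vec v)"
proof -
  have "cvec_norm v = 0 \<longleftrightarrow> (\<forall>i<dim_vec v. v $ i = 0)"
    by (auto simp: cvec_norm_def L2_set_def sum_nonneg_eq_0_iff)
  then show ?thesis
    by (auto simp: vec_eq_iff)
qed

text \<open>
  A square matrix with trivial kernel is surjective, so residual zero is attained and every
  minimizer attains it.  Both least squares problems of the method are of this kind, which is why
  the freedom in choosing a minimizer does no harm.
\<close>

lemma least_squares_exact:
  assumes A: "A \<in> carrier_mat n n" and b: "b \<in> carrier_vec n"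
    and inj: "\<And>v. v \<in> carrier_vec n \<Longrightarrow> A *\<^sub>v v = 0\<^sub>v n \<Longrightarrow> v = 0\<^sub>v n"
    and u: "least_squares_solution A b u"
  shows "u \<in> carrier_vec n" and "A *\<^sub>v u = b"
proof -
  have "det A \<noteq> 0"
    using inj det_0_iff_vec_prod_zero_field[OF A] by auto
  then obtain B where B: "B \<in> carrier_mat n n" "A * B = 1\<^sub>m n"
    using det_non_zero_imp_unit[OF A]
    unfolding Units_def by (auto simp: ring_mat_def)
  have v: "B *\<^sub>v b \<in> carrier_vec n" "A *\<^sub>v (B *\<^sub>v b) = b"
    using A B b by (auto simp flip: assoc_mult_mat_vec)
  show uc: "u \<in> carrier_vec n"
    using u A by (auto simp: least_squares_solution_def is_arg_min_def)
  have "\<not> cvec_norm (A *\<^sub>v (B *\<^sub>v b) - b) < cvec_norm (A *\<^sub>v u - b)"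
    using u v A by (auto simp: least_squares_solution_def is_arg_min_def)
  moreover have "cvec_norm (A *\<^sub>v (B *\<^sub>v b) - b) = 0"
    using v b by (auto simp: cvec_norm_eq_0_iff)
  moreover have "0 \<le> cvec_norm (A *\<^sub>v u - b)"
    by (simp add: cvec_norm_def)
  ultimately have "cvec_norm (A *\<^sub>v u - b) = 0" by linarith
  then have "A *\<^sub>v u - b = 0\<^sub>v n"
    using A uc b by (auto simp: cvec_norm_eq_0_iff)
  then have "(A *\<^sub>v u - b) $ i = 0" if "i < n" for i
    using that by simp
  then show "A *\<^sub>v u = b"
    using A uc b by (auto simp: vec_eq_iff)
qed

section \<open>Coefficient norms and Lagrange interpolation\<close>

text \<open>
  A polynomial is used below as a list of weights for consecutive samples; the sum of the moduli of
  its coefficients is then the factor by which it can amplify bounded noise.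
\<close>

definition l1_norm :: "complex poly \<Rightarrow> real" where
  "l1_norm p = (\<Sum>i\<le>degree p. cmod (coeff p i))"

lemma l1_norm_eq_sum:
  assumes "degree p < N" shows "l1_norm p = (\<Sum>i<N. cmod (coeff p i))"
  unfolding l1_norm_def
  by (rule sum.mono_neutral_left) (use assms in \<open>auto intro: coeff_eq_0\<close>)

lemma l1_norm_nonneg [simp]: "0 \<le> l1_norm p"
  by (simp add: l1_norm_def sum_nonneg)

lemma l1_norm_eq_0_iff: "l1_norm p = 0 \<longleftrightarrow> p = 0"
  by (auto simp: l1_norm_def sum_nonneg_eq_0_iff dest: leading_coeff_0_iff[THEN iffD1])

lemma l1_norm_smult: "l1_norm (Polynomial.smult c p) = cmod c * l1_norm p"
  by (cases "c = 0") (auto simp: l1_norm_def norm_mult sum_distrib_left)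

lemma l1_norm_add: "l1_norm (p + q) \<le> l1_norm p + l1_norm q"
proof -
  let ?N = "Suc (max (degree p) (degree q))"
  have "l1_norm (p + q) = (\<Sum>i<?N. cmod (coeff p i + coeff q i))"
    by (subst l1_norm_eq_sum[of _ ?N]) (auto intro: degree_add_le simp: less_Suc_eq_le simp del: sum.lessThan_Suc)
  also have "\<dots> \<le> (\<Sum>i<?N. cmod (coeff p i) + cmod (coeff q i))"
    by (intro sum_mono norm_triangle_ineq)
  also have "\<dots> = l1_norm p + l1_norm q"
    by (simp add: sum.distrib l1_norm_eq_sum[of p ?N] l1_norm_eq_sum[of q ?N] less_Suc_eq_le del: sum.lessThan_Suc)
  finally show ?thesis .
qed

lemma l1_norm_sum: "l1_norm (\<Sum>i\<in>A. f i) \<le> (\<Sum>i\<in>A. l1_norm (f i))"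
proof (induction A rule: infinite_finite_induct)
  case (insert x F)
  then show ?case using l1_norm_add[of "f x" "\<Sum>i\<in>F. f i"] by simp
qed (auto simp: l1_norm_def)

lemma l1_norm_pCons_0: "l1_norm (pCons 0 p) = l1_norm p"
proof (cases "p = 0")
  case False
  then show ?thesis
    by (simp add: l1_norm_def sum.atMost_Suc_shift del: sum.atMost_Suc)
qed simp

lemma l1_norm_linear_factor: "l1_norm ([:- c, 1:] * p) \<le> (1 + cmod c) * l1_norm p"
proof -
  have "[:- c, 1:] * p = Polynomial.smult (- c) p + pCons 0 p"
    by simp
  also have "l1_norm \<dots> \<le> cmod c * l1_norm p + l1_norm p"
    using l1_norm_add[of "Polynomial.smult (- c) p" "pCons 0 p"]
    by (simp only: l1_norm_smult l1_norm_pCons_0 norm_minus_cancel)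
  finally show ?thesis by (simp add: algebra_simps)
qed

lemma l1_norm_prod_linear_factors:
  assumes "finite I" and "\<And>i. i \<in> I \<Longrightarrow> cmod (z i) \<le> 1"
  shows "l1_norm (\<Prod>i\<in>I. [:- z i, 1:]) \<le> 2 ^ card I"
  using assms
proof (induction I rule: finite_induct)
  case empty
  then show ?case by (simp add: l1_norm_def)
next
  case (insert x F)
  have "l1_norm (\<Prod>i\<in>insert x F. [:- z i, 1:]) \<le> (1 + cmod (z x)) * l1_norm (\<Prod>i\<in>F. [:- z i, 1:])"
    using insert.hyps by (simp only: prod.insert l1_norm_linear_factor simp_thms)
  also have "\<dots> \<le> 2 * 2 ^ card F"
    using insert by (intro mult_mono) auto
  finally show ?case using insert.hyps by simp
qed

definition lagrange :: "nat \<Rightarrow> (nat \<Rightarrow> complex) \<Rightarrow> nat \<Rightarrow> complex poly" where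
  "lagrange n z j =
     Polynomial.smult (inverse (\<Prod>i\<in>{..<n} - {j}. z j - z i)) (\<Prod>i\<in>{..<n} - {j}. [:- z i, 1:])"

lemma poly_lagrange:
  "poly (lagrange n z j) w = (\<Prod>i\<in>{..<n} - {j}. (w - z i) / (z j - z i))"
  by (simp add: lagrange_def poly_prod prod_dividef field_simps)

lemma degree_prod_linear_factors: "degree (\<Prod>i\<in>I. [:- z i, 1::complex:]) = card I"
  by (subst degree_prod_sum_eq) auto

lemma degree_lagrange:
  assumes "j < n" shows "degree (lagrange n z j) \<le> n - 1"
  using assms by (auto simp: lagrange_def degree_prod_linear_factors intro: order.trans[OF degree_smult_le])

lemma poly_lagrange_node:
  assumes "inj_on z {..<n}" "j < n" "k < n"
  shows "poly (lagrange n z j) (z k) = (if k = j then 1 else 0)"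
proof (cases "k = j")
  case True
  then show ?thesis
    using inj_onD[OF assms(1), of j] assms
    by (auto simp: poly_lagrange intro!: prod.neutral split: if_splits)
next
  case False
  then have "(\<Prod>i\<in>{..<n} - {j}. (z k - z i) / (z j - z i)) = 0"
    using assms by (intro prod_zero) auto
  with False show ?thesis by (simp add: poly_lagrange)
qed

text \<open>
  Each of the \<open>n - 1\<close> linear factors in the numerator has norm at most \<open>2\<close>, and each of the
  \<open>n - 1\<close> differences in the denominator is at least \<open>s\<close>.  This is where every negative power of
  the separation in the final estimates comes from.
\<close>

lemma l1_norm_lagrange_le:
  assumes "0 < s" "j < n" "\<And>i. i < n \<Longrightarrow> cmod (z i) \<le> 1"
    and sep: "\<And>i k. i < n \<Longrightarrow> k < n \<Longrightarrow> i \<noteq> k \<Longrightarrow> s \<le> cmod (z i - z k)"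
  shows "l1_norm (lagrange n z j) \<le> (2 / s) ^ (n - 1)"
proof -
  have card: "card ({..<n} - {j}) = n - 1"
    using \<open>j < n\<close> by simp
  have "s ^ (n - 1) = (\<Prod>i\<in>{..<n} - {j}. s)"
    by (simp add: card)
  also have "\<dots> \<le> (\<Prod>i\<in>{..<n} - {j}. cmod (z j - z i))"
    using assms by (intro prod_mono) auto
  finally have den: "s ^ (n - 1) \<le> cmod (\<Prod>i\<in>{..<n} - {j}. z j - z i)"
    by (simp add: prod_norm)
  have num: "l1_norm (\<Prod>i\<in>{..<n} - {j}. [:- z i, 1:]) \<le> 2 ^ (n - 1)"
    using l1_norm_prod_linear_factors[of "{..<n} - {j}" z] assms(3) card by simp
  have "l1_norm (lagrange n z j) =
      l1_norm (\<Prod>i\<in>{..<n} - {j}. [:- z i, 1:]) / cmod (\<Prod>i\<in>{..<n} - {j}. z j - z i)"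
    by (simp add: lagrange_def l1_norm_smult norm_inverse divide_inverse mult.commute)
  also have "\<dots> \<le> 2 ^ (n - 1) / s ^ (n - 1)"
    using num den \<open>0 < s\<close> by (intro frac_le) auto
  finally show ?thesis by (simp add: power_divide)
qed

lemma lagrange_interpolation:
  assumes inj: "inj_on z {..<n}" and deg: "degree p < n"
  shows "p = (\<Sum>j<n. Polynomial.smult (poly p (z j)) (lagrange n z j))"
proof (rule poly_eqI_degree[where A = "z ` {..<n}"])
  show "poly p w = poly (\<Sum>j<n. Polynomial.smult (poly p (z j)) (lagrange n z j)) w" if "w \<in> z ` {..<n}" for w
    using that inj
    by (auto simp: poly_sum poly_lagrange_node if_distrib[of "\<lambda>x. _ * x"] cong: if_cong)
  show "degree p < card (z ` {..<n})"
    using inj deg by (simp add: card_image)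
  have "degree (\<Sum>j<n. Polynomial.smult (poly p (z j)) (lagrange n z j)) \<le> n - 1"
    by (intro degree_sum_le) (simp_all add: order.trans[OF degree_smult_le] degree_lagrange del: One_nat_def)
  then show "degree (\<Sum>j<n. Polynomial.smult (poly p (z j)) (lagrange n z j)) < card (z ` {..<n})"
    using inj deg by (simp add: card_image)
qed

lemma l1_norm_le_values:
  assumes "inj_on z {..<n}" "degree p < n" "\<And>j. j < n \<Longrightarrow> l1_norm (lagrange n z j) \<le> L"
    "\<And>j. j < n \<Longrightarrow> cmod (poly p (z j)) \<le> K"
  shows "l1_norm p \<le> real n * K * L"
proof -
  have "l1_norm p \<le> (\<Sum>j<n. l1_norm (Polynomial.smult (poly p (z j)) (lagrange n z j)))"
    by (subst lagrange_interpolation[OF assms(1,2)]) (rule l1_norm_sum)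
  also have "\<dots> \<le> (\<Sum>j<n. K * L)"
    unfolding l1_norm_smult using assms(3,4)
    by (intro sum_mono mult_mono) (auto intro: order.trans[OF norm_ge_zero])
  finally show ?thesis by simp
qed

lemma poly_eq_sum_coeff:
  fixes p :: "complex poly"
  assumes "degree p < N" shows "poly p w = (\<Sum>i<N. coeff p i * w ^ i)"
  unfolding poly_altdef
  by (rule sum.mono_neutral_left) (use assms in \<open>auto intro: coeff_eq_0\<close>)

section \<open>Perturbation of the roots in Prony's method\<close>

text \<open>
  Suppose that the coefficients of \<open>P\<close> annihilate \<open>n\<close> consecutive windows of the samples.  Combine
  these \<open>n\<close> equations with the coefficients of the \<open>j\<close>-th Lagrange polynomial as weights: in the
  noiseless part only the node \<open>z j\<close> survives and contributes \<open>\<alpha> j * poly P (z j)\<close>, and this must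
  be balanced by the weighted noise.
\<close>

lemma annihilator_small_at_nodes:
  fixes z \<alpha> e m :: "nat \<Rightarrow> complex" and P :: "complex poly"
  assumes inj: "inj_on z {..<n}" and deg: "degree P \<le> n" and "j < n"
    and m: "\<And>k. k < 2 * n \<Longrightarrow> m k = (\<Sum>j<n. \<alpha> j * z j ^ k) + e k"
    and e: "\<And>k. k < 2 * n \<Longrightarrow> cmod (e k) \<le> \<epsilon>"
    and ann: "\<And>i. i < n \<Longrightarrow> (\<Sum>k<Suc n. coeff P k * m (i + k)) = 0"
  shows "cmod (\<alpha> j) * cmod (poly P (z j)) \<le> l1_norm (lagrange n z j) * \<epsilon> * l1_norm P"
proof -
  define l where "l = coeff (lagrange n z j)"
  define p where "p = coeff P"
  have dL: "degree (lagrange n z j) < n"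
    using degree_lagrange[OF \<open>j < n\<close>, of z] \<open>j < n\<close> by linarith
  have dP: "degree P < Suc n"
    using deg by simp
  define E where "E = (\<Sum>i<n. \<Sum>k<Suc n. l i * p k * e (i + k))"
  have "0 = (\<Sum>i<n. l i * (\<Sum>k<Suc n. p k * m (i + k)))"
    using ann by (simp add: p_def)
  also have "\<dots> = (\<Sum>i<n. \<Sum>k<Suc n. l i * p k * m (i + k))"
    by (simp add: sum_distrib_left mult.assoc del: sum.lessThan_Suc)
  also have "\<dots> = (\<Sum>i<n. \<Sum>k<Suc n. (\<Sum>s<n. \<alpha> s * ((l i * z s ^ i) * (p k * z s ^ k))) + l i * p k * e (i + k))"
    by (intro sum.cong refl)
       (simp add: m distrib_left sum_distrib_left power_add mult.assoc mult.left_commute)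
  also have "\<dots> = (\<Sum>i<n. \<Sum>k<Suc n. \<Sum>s<n. \<alpha> s * ((l i * z s ^ i) * (p k * z s ^ k))) + E"
    by (simp add: sum.distrib E_def del: sum.lessThan_Suc)
  also have "(\<Sum>i<n. \<Sum>k<Suc n. \<Sum>s<n. \<alpha> s * ((l i * z s ^ i) * (p k * z s ^ k)))
      = (\<Sum>i<n. \<Sum>s<n. \<Sum>k<Suc n. \<alpha> s * ((l i * z s ^ i) * (p k * z s ^ k)))"
    by (intro sum.cong refl sum.swap)
  also have "\<dots> = (\<Sum>s<n. \<Sum>i<n. \<Sum>k<Suc n. \<alpha> s * ((l i * z s ^ i) * (p k * z s ^ k)))"
    by (rule sum.swap)
  also have "\<dots> = (\<Sum>s<n. \<alpha> s * ((\<Sum>i<n. l i * z s ^ i) * (\<Sum>k<Suc n. p k * z s ^ k)))"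
    by (simp only: sum_product) (simp only: sum_distrib_left)
  also have "\<dots> = (\<Sum>s<n. \<alpha> s * (poly (lagrange n z j) (z s) * poly P (z s)))"
    by (simp add: poly_eq_sum_coeff[OF dL] poly_eq_sum_coeff[OF dP] l_def p_def del: sum.lessThan_Suc)
  also have "\<dots> = (\<Sum>s<n. if s = j then \<alpha> s * poly P (z s) else 0)"
    using inj \<open>j < n\<close> by (intro sum.cong refl) (auto simp: poly_lagrange_node)
  also have "\<dots> = \<alpha> j * poly P (z j)"
    using \<open>j < n\<close> by simp
  finally have "cmod (\<alpha> j * poly P (z j)) = cmod E"
    by (metis add_eq_0_iff norm_minus_cancel)
  also have "\<dots> \<le> (\<Sum>i<n. \<Sum>k<Suc n. cmod (l i) * \<epsilon> * cmod (p k))"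
    unfolding E_def
  proof (intro sum_norm_le)
    fix i k assume "i \<in> {..<n}" "k \<in> {..<Suc n}"
    then have "cmod (e (i + k)) \<le> \<epsilon>"
      by (intro e) auto
    then have "cmod (l i) * cmod (p k) * cmod (e (i + k)) \<le> cmod (l i) * cmod (p k) * \<epsilon>"
      by (intro mult_left_mono) auto
    then show "cmod (l i * p k * e (i + k)) \<le> cmod (l i) * \<epsilon> * cmod (p k)"
      by (simp add: norm_mult algebra_simps)
  qed
  also have "\<dots> = (\<Sum>i<n. cmod (l i)) * \<epsilon> * (\<Sum>k<Suc n. cmod (p k))"
    by (simp only: sum_distrib_right[where r = \<epsilon>] sum_product)
  also have "\<dots> = l1_norm (lagrange n z j) * \<epsilon> * l1_norm P"
    by (simp only: l1_norm_eq_sum[OF dL] l1_norm_eq_sum[OF dP] l_def p_def)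
  finally show ?thesis by (simp add: norm_mult)
qed

lemma hankel_mult_vec_index:
  assumes "v \<in> carrier_vec n" "i < n"
  shows "(hankel n m *\<^sub>v v) $ i = (\<Sum>k<n. v $ k * m (i + k))"
  using assms by (auto simp: hankel_def scalar_prod_def atLeast0LessThan mult.commute intro!: sum.cong)

lemma coeff_sum_monom: "coeff (\<Sum>i<n. monom (f i) i) k = (if k < n then f k else 0)"
  by (simp add: coeff_sum)

lemma coeff_monic_poly:
  "coeff (monic_poly n q) k = (if k < n then q $ k else if k = n then 1 else 0)"
  by (simp add: monic_poly_def coeff_sum_monom)

lemma degree_monic_poly: "degree (monic_poly n q) \<le> n"
  by (intro degree_le) (auto simp: coeff_monic_poly)

lemma ex_small_factor:
  fixes f :: "nat \<Rightarrow> real"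
  assumes "\<And>k. k < n \<Longrightarrow> 0 \<le> f k" "(\<Prod>k<n. f k) < r ^ n" "0 \<le> r"
  shows "\<exists>k<n. f k < r"
proof (rule ccontr)
  assume "\<not> ?thesis"
  then have "(\<Prod>k<n. r) \<le> (\<Prod>k<n. f k)"
    using assms by (intro prod_mono) auto
  then show False using assms by simp
qed

text \<open>
  A product of \<open>n\<close> distances below \<open>(s / 4) ^ n\<close> contains a distance below \<open>s / 4\<close>, and by the
  separation different nodes find different roots.  Hence the roots are matched with the nodes, the
  \<open>n - 1\<close> roots matched with other nodes stay \<open>s / 2\<close> away from \<open>z j\<close>, and dividing by their
  distances bounds the remaining one linearly in \<open>\<rho>\<close>, instead of by an \<open>n\<close>-th root of it.
\<close>

lemma roots_near_nodes:
  fixes z w :: "nat \<Rightarrow> complex"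
  assumes s: "0 < s" and sep: "\<And>i k. i < n \<Longrightarrow> k < n \<Longrightarrow> i \<noteq> k \<Longrightarrow> s \<le> cmod (z i - z k)"
    and small: "\<And>j. j < n \<Longrightarrow> (\<Prod>k<n. cmod (z j - w k)) \<le> \<rho>" and \<rho>: "\<rho> < (s / 4) ^ n"
  shows "\<exists>\<sigma>. \<sigma> permutes {..<n} \<and> (\<forall>j<n. cmod (z j - w (\<sigma> j)) \<le> \<rho> * (2 / s) ^ (n - 1))"
proof -
  have "\<exists>k<n. cmod (z j - w k) < s / 4" if "j < n" for j
    using small[OF that] \<rho> s by (intro ex_small_factor) auto
  then obtain f where f: "\<And>j. j < n \<Longrightarrow> f j < n" "\<And>j. j < n \<Longrightarrow> cmod (z j - w (f j)) < s / 4"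
    by metis
  have inj: "inj_on f {..<n}"
  proof (rule inj_onI, rule ccontr)
    fix i j assume ij: "i \<in> {..<n}" "j \<in> {..<n}" "f i = f j" "i \<noteq> j"
    have "cmod (z i - z j) \<le> cmod (z i - w (f i)) + cmod (z j - w (f j))"
      using norm_triangle_ineq4[of "z i - w (f i)" "z j - w (f j)"] ij(3) by simp
    also have "\<dots> < s"
      using f(2)[of i] f(2)[of j] ij s by auto
    finally show False using sep[of i j] ij by auto
  qed
  then have img: "f ` {..<n} = {..<n}"
    using f(1) by (intro endo_inj_surj) auto
  define \<sigma> where "\<sigma> = (\<lambda>j. if j < n then f j else j)"
  have "inj_on \<sigma> {..<n}" "\<sigma> ` {..<n} = f ` {..<n}"
    using inj by (auto simp: \<sigma>_def inj_on_def intro!: image_cong)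
  then have "bij_betw \<sigma> {..<n} {..<n}"
    using img by (simp add: bij_betw_def)
  then have "\<sigma> permutes {..<n}"
    by (rule bij_imp_permutes) (simp add: \<sigma>_def)
  moreover have "cmod (z j - w (\<sigma> j)) \<le> \<rho> * (2 / s) ^ (n - 1)" if j: "j < n" for j
  proof -
    have far: "s / 2 \<le> cmod (z j - w k)" if k: "k \<in> {..<n} - {f j}" for k
    proof -
      from k img obtain i where i: "i < n" "k = f i" "i \<noteq> j" by blast
      have "s \<le> cmod (z j - z i)" using sep[of j i] i j by auto
      also have "\<dots> \<le> cmod (z j - w k) + cmod (z i - w (f i))"
        using norm_triangle_ineq4[of "z j - w k" "z i - w k"] i(2) by simp
      finally show ?thesis using f(2)[OF i(1)] s by linarith
    qed
    have "cmod (z j - w (f j)) * (s / 2) ^ (n - 1) =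
        cmod (z j - w (f j)) * (\<Prod>k\<in>{..<n} - {f j}. s / 2)"
      using f(1)[OF j] by simp
    also have "\<dots> \<le> cmod (z j - w (f j)) * (\<Prod>k\<in>{..<n} - {f j}. cmod (z j - w k))"
      using far s by (intro mult_left_mono prod_mono) auto
    also have "\<dots> = (\<Prod>k<n. cmod (z j - w k))"
      using f(1)[OF j] by (simp add: prod.remove[of "{..<n}" "f j"])
    also have "\<dots> \<le> \<rho>" using small[OF j] .
    finally have "cmod (z j - w (f j)) \<le> \<rho> / (s / 2) ^ (n - 1)"
      using s by (simp add: pos_le_divide_eq)
    then show ?thesis using j s by (simp add: \<sigma>_def power_divide)
  qed
  ultimately show ?thesis by blast
qed

text \<open>
  The factor \<open>s ^ (n - 1)\<close> is lost twice: once when the recurrences are turned into a bound for the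
  Prony polynomial at the nodes, and once more when values at the nodes are turned into distances of
  roots.  The first bound contains the coefficient norm of the Prony polynomial itself; for small
  noise that term is absorbed, by interpolating the difference of the Prony polynomial and the
  polynomial with the true roots.  The same absorption, applied to a vector in the kernel of the
  Hankel matrix, shows that the matrix is invertible.
\<close>

lemma prony_roots_error:
  fixes z \<alpha> e m w :: "nat \<Rightarrow> complex" and s \<mu> \<epsilon> :: real
  assumes n: "0 < n" and s: "0 < s" "s \<le> 1" and \<mu>: "0 < \<mu>" and \<epsilon>: "0 \<le> \<epsilon>"
    and unit: "\<And>i. i < n \<Longrightarrow> cmod (z i) \<le> 1"
    and sep: "\<And>i k. i < n \<Longrightarrow> k < n \<Longrightarrow> i \<noteq> k \<Longrightarrow> s \<le> cmod (z i - z k)"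
    and amp: "\<And>i. i < n \<Longrightarrow> \<mu> \<le> cmod (\<alpha> i)"
    and m: "\<And>k. k < 2 * n \<Longrightarrow> m k = (\<Sum>j<n. \<alpha> j * z j ^ k) + e k"
    and e: "\<And>k. k < 2 * n \<Longrightarrow> cmod (e k) \<le> \<epsilon>"
    and small: "\<epsilon> < \<mu> * s ^ (2 * n - 1) / 16 ^ n"
    and q: "least_squares_solution (hankel n m) (- vec n (\<lambda>k. m (n + k))) q"
    and w: "monic_poly n q = (\<Prod>k<n. [:- w k, 1:])"
  shows "\<exists>\<sigma>. \<sigma> permutes {..<n} \<and>
           (\<forall>j<n. cmod (z j - w (\<sigma> j)) \<le> 8 ^ n * \<epsilon> / (\<mu> * s ^ (2 * n - 2)))"
proof -
  obtain N where N: "n = Suc N" using n by (cases n) auto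
  define L where "L = (2 / s) ^ (n - 1)"
  define K where "K = L * \<epsilon> / \<mu>"
  have pos: "0 < s ^ N" "0 < L" "0 \<le> K"
    using s \<mu> \<epsilon> by (auto simp: L_def K_def)
  have s_pow: "s ^ (2 * n - 1) = s ^ N * s ^ N * s" "s ^ (2 * n - 2) = s ^ N * s ^ N"
    by (simp_all add: N mult_2 power_add)
  have four: "(4::real) ^ N = 2 ^ N * 2 ^ N"
    by (simp flip: power_mult_distrib)
  have L_eq: "L = 2 ^ N / s ^ N"
    by (simp add: L_def N power_divide)
  have inj: "inj_on z {..<n}"
    using sep s by (intro inj_onI) force
  have lagr: "l1_norm (lagrange n z j) \<le> L" if "j < n" for j
    unfolding L_def using l1_norm_lagrange_le[OF s(1) that unit sep] by simp

  have at_nodes: "cmod (poly P (z j)) \<le> K * l1_norm P"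
    if P: "degree P \<le> n" "\<And>i. i < n \<Longrightarrow> (\<Sum>k<Suc n. coeff P k * m (i + k)) = 0"
      and j: "j < n" for P j
  proof -
    have "\<mu> * cmod (poly P (z j)) \<le> cmod (\<alpha> j) * cmod (poly P (z j))"
      using amp[OF j] by (intro mult_right_mono) auto
    also have "\<dots> \<le> l1_norm (lagrange n z j) * \<epsilon> * l1_norm P"
      by (rule annihilator_small_at_nodes[OF inj P(1) j m e P(2)])
    also have "\<dots> \<le> L * \<epsilon> * l1_norm P"
      using lagr[OF j] \<epsilon> by (intro mult_right_mono) auto
    finally show ?thesis
      using \<mu> by (simp add: K_def field_simps)
  qed

  \<comment> \<open>The absorption factor: \<open>K\<close> bounds values by norms, \<open>n * L\<close> norms by values.
    The constant \<open>16 ^ n\<close> in the noise bound makes the product at most \<open>1 / 2\<close>.\<close>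
  have half: "real n * K * L \<le> 1 / 2"
  proof -
    have "K * L = 4 ^ N * (\<epsilon> / \<mu>) / (s ^ N * s ^ N)"
      by (simp add: K_def L_eq four mult_ac)
    also have "\<epsilon> / \<mu> \<le> s ^ N * s ^ N * s / 16 ^ n"
      using small[unfolded s_pow] \<mu> by (simp add: field_simps)
    then have "4 ^ N * (\<epsilon> / \<mu>) / (s ^ N * s ^ N) \<le> 4 ^ N * (s ^ N * s ^ N * s / 16 ^ n) / (s ^ N * s ^ N)"
      using pos by (intro divide_right_mono mult_left_mono) auto
    also have "\<dots> = 4 ^ N * s / 16 ^ n"
      using s by simp
    also have "\<dots> \<le> 4 ^ N * 1 / 16 ^ n"
      using s by (intro divide_right_mono mult_left_mono) auto
    also have "\<dots> = 1 / (16 * 4 ^ N)"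
    proof -
      have "(16::real) ^ N = 4 ^ N * 4 ^ N"
        by (simp flip: power_mult_distrib)
      then show ?thesis by (simp add: N)
    qed
    finally have "real n * (K * L) \<le> real n * (1 / (16 * 4 ^ N))"
      by (intro mult_left_mono) auto
    also have "\<dots> \<le> 1 / 2"
    proof -
      have "real n \<le> 2 ^ n"
        using of_nat_less_two_power[of n, where 'a = real] by linarith
      also have "\<dots> \<le> 8 * 4 ^ N"
      proof -
        have "(2::real) ^ N \<le> 4 ^ N" "0 \<le> (4::real) ^ N"
          by (auto intro: power_mono)
        then show ?thesis unfolding N power_Suc by linarith
      qed
      finally show ?thesis by (simp add: field_simps)
    qed
    finally show ?thesis by (simp add: mult.assoc)
  qed

  have l1_half: "l1_norm P \<le> 1 / 2 * B"
    if "degree P < n" "\<And>j. j < n \<Longrightarrow> cmod (poly P (z j)) \<le> K * B" "0 \<le> B" for P B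
  proof -
    have "l1_norm P \<le> real n * (K * B) * L"
      using l1_norm_le_values[OF inj that(1) lagr that(2)] .
    also have "\<dots> = (real n * K * L) * B"
      by simp
    also have "\<dots> \<le> 1 / 2 * B"
      using half that(3) by (intro mult_right_mono) auto
    finally show ?thesis .
  qed

  have ker: "v = 0\<^sub>v n" if v: "v \<in> carrier_vec n" "hankel n m *\<^sub>v v = 0\<^sub>v n" for v
  proof -
    define P where "P = (\<Sum>i<n. monom (v $ i) i)"
    have coeff_P: "coeff P k = (if k < n then v $ k else 0)" for k
      by (simp add: P_def coeff_sum_monom)
    have deg: "degree P < n"
      using n by (intro degree_lessI) (auto simp: coeff_P)
    have "(\<Sum>k<Suc n. coeff P k * m (i + k)) = (hankel n m *\<^sub>v v) $ i" if "i < n" for i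
      using hankel_mult_vec_index[OF v(1) that] by (simp add: coeff_P)
    then have "cmod (poly P (z j)) \<le> K * l1_norm P" if "j < n" for j
      using deg v(2) that by (intro at_nodes) auto
    then have "l1_norm P \<le> 1 / 2 * l1_norm P"
      using deg by (intro l1_half) auto
    then have "l1_norm P = 0"
      using l1_norm_nonneg[of P] by linarith
    then have "P = 0"
      by (simp add: l1_norm_eq_0_iff)
    then have "v $ k = 0" if "k < n" for k
      using coeff_P[of k] that by simp
    then show ?thesis
      using v(1) by (auto simp: vec_eq_iff)
  qed

  define Q where "Q = monic_poly n q"
  have H: "hankel n m \<in> carrier_mat n n" "- vec n (\<lambda>k. m (n + k)) \<in> carrier_vec n"
    by (auto simp: hankel_def)
  note exact = least_squares_exact[OF H ker q]
  have annQ: "(\<Sum>k<Suc n. coeff Q k * m (i + k)) = 0" if "i < n" for i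
  proof -
    have "(\<Sum>k<Suc n. coeff Q k * m (i + k)) = (hankel n m *\<^sub>v q) $ i + m (i + n)"
      using hankel_mult_vec_index[OF exact(1) that] by (simp add: Q_def coeff_monic_poly)
    then show ?thesis
      using that by (simp add: exact(2) add.commute)
  qed
  define p0 where "p0 = (\<Prod>k<n. [:- z k, 1:])"
  have p0: "degree p0 = n" "l1_norm p0 \<le> 2 ^ n" "lead_coeff p0 = 1"
    using l1_norm_prod_linear_factors[of "{..<n}" z] unit
    unfolding p0_def lead_coeff_prod by (simp_all add: degree_prod_linear_factors)
  have poly_p0: "poly p0 (z j) = 0" if "j < n" for j
    using that by (auto simp: p0_def poly_prod)
  have degQ: "degree Q \<le> n" "coeff Q n = 1"
    by (simp_all add: Q_def degree_monic_poly coeff_monic_poly)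
  have Q_at_nodes: "cmod (poly Q (z j)) \<le> K * l1_norm Q" if "j < n" for j
    using degQ annQ that by (intro at_nodes) auto
  have deg_diff: "degree (Q - p0) < n"
  proof (rule degree_lessI)
    show "Q - p0 \<noteq> 0 \<or> 0 < n" using n by simp
    show "\<forall>k\<ge>n. coeff (Q - p0) k = 0"
    proof (intro allI impI)
      fix k assume "n \<le> k"
      then show "coeff (Q - p0) k = 0"
        using degQ p0 by (cases "k = n") (auto simp: coeff_eq_0)
    qed
  qed
  have "l1_norm Q \<le> l1_norm p0 + l1_norm (Q - p0)"
    using l1_norm_add[of p0 "Q - p0"] by simp
  also have "l1_norm (Q - p0) \<le> 1 / 2 * l1_norm Q"
    using deg_diff Q_at_nodes by (intro l1_half) (auto simp: poly_p0)
  finally have l1_Q: "l1_norm Q \<le> 2 * 2 ^ n"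
    using p0(2) by linarith

  define \<rho> where "\<rho> = K * (2 * 2 ^ n)"
  have "(\<Prod>k<n. cmod (z j - w k)) \<le> \<rho>" if "j < n" for j
  proof -
    have "(\<Prod>k<n. cmod (z j - w k)) = cmod (poly Q (z j))"
      unfolding Q_def w by (simp add: poly_prod prod_norm)
    also have "\<dots> \<le> K * l1_norm Q" by (rule Q_at_nodes[OF that])
    also have "\<dots> \<le> \<rho>" unfolding \<rho>_def using pos l1_Q by (intro mult_left_mono) auto
    finally show ?thesis .
  qed
  moreover have \<rho>_eq: "\<rho> = 4 ^ n * \<epsilon> / (\<mu> * s ^ N)"
    by (simp add: \<rho>_def K_def L_eq N four mult_ac)
  have "\<rho> < (s / 4) ^ n"
  proof -
    have "\<epsilon> * (16 ^ n) < \<mu> * (s ^ N * s ^ N * s)"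
      using small[unfolded s_pow] by (simp add: field_simps)
    moreover have "(16::real) ^ n = 4 ^ n * 4 ^ n"
      by (simp flip: power_mult_distrib)
    moreover have "s ^ n = s * s ^ N"
      by (simp add: N)
    ultimately have "4 ^ n * \<epsilon> * 4 ^ n < s ^ n * (\<mu> * s ^ N)"
      by (simp only: mult_ac)
    then have "4 ^ n * \<epsilon> < s ^ n * (\<mu> * s ^ N) / 4 ^ n"
      by (simp add: pos_less_divide_eq)
    then show ?thesis
      using \<mu> pos by (simp add: \<rho>_eq power_divide pos_divide_less_eq)
  qed
  ultimately obtain \<sigma> where "\<sigma> permutes {..<n}"
      "\<And>j. j < n \<Longrightarrow> cmod (z j - w (\<sigma> j)) \<le> \<rho> * (2 / s) ^ (n - 1)"
    using roots_near_nodes[where n = n and z = z and w = w and \<rho> = \<rho>, OF s(1) sep] by auto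
  moreover have "\<rho> * (2 / s) ^ (n - 1) \<le> 8 ^ n * \<epsilon> / (\<mu> * s ^ (2 * n - 2))"
  proof -
    have "\<rho> * (2 / s) ^ (n - 1) = (4 ^ n * 2 ^ N) * \<epsilon> / (\<mu> * (s ^ N * s ^ N))"
      by (simp add: \<rho>_eq N power_divide mult_ac)
    also have "\<dots> \<le> 8 ^ n * \<epsilon> / (\<mu> * (s ^ N * s ^ N))"
    proof (intro divide_right_mono mult_right_mono)
      have "(4::real) ^ n * 2 ^ N \<le> 4 ^ n * 2 ^ n" by (simp add: N)
      also have "\<dots> = 8 ^ n" by (simp flip: power_mult_distrib)
      finally show "(4::real) ^ n * 2 ^ N \<le> 8 ^ n" .
    qed (use \<mu> \<epsilon> pos in auto)
    finally show ?thesis by (simp only: s_pow)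
  qed
  ultimately show ?thesis
    by (intro exI[of _ \<sigma>]) (auto intro: order.trans)
qed

section \<open>Perturbation of the amplitudes\<close>

text \<open>
  The coefficients of the Lagrange polynomials are the rows of the inverse Vandermonde matrix.
\<close>

lemma vandermonde_inversion:
  assumes "inj_on w {..<n}" "j < n"
  shows "(\<Sum>k<n. coeff (lagrange n w j) k * (\<Sum>i<n. b i * w i ^ k)) = b j"
proof -
  have d: "degree (lagrange n w j) < n"
    using degree_lagrange[OF assms(2), of w] assms(2) by linarith
  have "(\<Sum>k<n. coeff (lagrange n w j) k * (\<Sum>i<n. b i * w i ^ k))
      = (\<Sum>k<n. \<Sum>i<n. b i * (coeff (lagrange n w j) k * w i ^ k))"
    by (simp add: sum_distrib_left mult_ac)
  also have "\<dots> = (\<Sum>i<n. b i * poly (lagrange n w j) (w i))"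
    by (subst sum.swap) (simp add: sum_distrib_left poly_eq_sum_coeff[OF d])
  also have "\<dots> = (\<Sum>i<n. if i = j then b i else 0)"
    using assms by (intro sum.cong) (auto simp: poly_lagrange_node)
  finally show ?thesis using assms by simp
qed

text \<open>
  By Vandermonde inversion \<open>\<beta> j\<close> is the combination of the samples with the coefficients of the
  Lagrange polynomial \<open>l\<close> of the perturbed nodes \<open>w\<close>, while \<open>\<alpha> j\<close> is what one would get if the samples
  had been taken with nodes \<open>w\<close>.  So the error is noise, amplified by the norm of \<open>l\<close>, plus the
  differences \<open>poly l (z i) - poly l (w i)\<close>.  These are differences of products of \<open>n - 1\<close> ratios
  which are bounded by \<open>R\<close> and move by at most \<open>\<eta> / s\<close>; here only one power of \<open>s\<close> is lost, since
  all nodes lie within a distance comparable with \<open>s\<close>.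
\<close>

lemma amplitude_error:
  fixes z w \<alpha> \<beta> e :: "nat \<Rightarrow> complex" and R s \<eta> \<epsilon> M :: real
  assumes s: "0 < s" and R: "1 \<le> R" and \<epsilon>: "0 \<le> \<epsilon>" and \<eta>: "0 \<le> \<eta>" and j: "j < n"
    and unit: "\<And>i. i < n \<Longrightarrow> cmod (w i) \<le> 1"
    and sep: "\<And>i k. i < n \<Longrightarrow> k < n \<Longrightarrow> i \<noteq> k \<Longrightarrow> s \<le> cmod (w i - w k)"
    and close: "\<And>i. i < n \<Longrightarrow> cmod (z i - w i) \<le> \<eta>"
    and diam: "\<And>i k. i < n \<Longrightarrow> k < n \<Longrightarrow> cmod (z i - w k) \<le> R * s"
      "\<And>i k. i < n \<Longrightarrow> k < n \<Longrightarrow> cmod (w i - w k) \<le> R * s"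
    and M: "\<And>i. i < n \<Longrightarrow> cmod (\<alpha> i) \<le> M"
    and e: "\<And>k. k < n \<Longrightarrow> cmod (e k) \<le> \<epsilon>"
    and eq: "\<And>k. k < n \<Longrightarrow> (\<Sum>i<n. \<beta> i * w i ^ k) = (\<Sum>i<n. \<alpha> i * z i ^ k) + e k"
  shows "cmod (\<alpha> j - \<beta> j) \<le> real n * (M * (R ^ n * (real n * (\<eta> / s)))) + (2 / s) ^ (n - 1) * \<epsilon>"
proof -
  define l where "l = lagrange n w j"
  have d: "degree l < n"
    using degree_lagrange[OF j, of w] j unfolding l_def by linarith
  have inj: "inj_on w {..<n}"
    using sep s by (intro inj_onI) force
  have diff: "cmod (poly l (z i) - poly l (w i)) \<le> R ^ n * (real n * (\<eta> / s))" if i: "i < n" for i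
  proof -
    let ?I = "{..<n} - {j}"
    \<comment> \<open>Dividing each ratio by \<open>R\<close> brings all factors into the unit disc.\<close>
    define u where "u = (\<lambda>k. (z i - w k) / (w j - w k) / of_real R)"
    define v where "v = (\<lambda>k. (w i - w k) / (w j - w k) / of_real R)"
    have l_eq: "poly l (z i) = of_real R ^ (n - 1) * (\<Prod>k\<in>?I. u k)"
      "poly l (w i) = of_real R ^ (n - 1) * (\<Prod>k\<in>?I. v k)"
      using R j by (simp_all add: l_def poly_lagrange u_def v_def prod_dividef prod.distrib)
    have ratio: "cmod (x / (w j - w k) / of_real R) \<le> t / s / R"
      if "k \<in> ?I" "cmod x \<le> t" for x k t
    proof -
      have "cmod x / cmod (w j - w k) \<le> t / s"
        using that sep[of j k] j s by (intro frac_le) (auto intro: order.trans[OF norm_ge_zero])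
      then have "cmod x / cmod (w j - w k) / R \<le> t / s / R"
        using R by (intro divide_right_mono) auto
      then show ?thesis
        using R by (simp only: norm_divide norm_of_real abs_of_pos)
    qed
    have "cmod (poly l (z i) - poly l (w i)) = R ^ (n - 1) * cmod ((\<Prod>k\<in>?I. u k) - (\<Prod>k\<in>?I. v k))"
      using R by (simp add: l_eq norm_mult norm_power flip: right_diff_distrib)
    also have "cmod ((\<Prod>k\<in>?I. u k) - (\<Prod>k\<in>?I. v k)) \<le> (\<Sum>k\<in>?I. cmod (u k - v k))"
    proof (rule norm_prod_diff)
      fix k assume k: "k \<in> ?I"
      show "cmod (u k) \<le> 1" "cmod (v k) \<le> 1"
        using ratio[OF k, of "z i - w k" "R * s"] ratio[OF k, of "w i - w k" "R * s"]
          diam[of i k] i k R s by (auto simp: u_def v_def)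
    qed
    also have "\<dots> \<le> (\<Sum>k\<in>?I. \<eta> / s)"
    proof (rule sum_mono)
      fix k assume k: "k \<in> ?I"
      have "u k - v k = (z i - w i) / (w j - w k) / of_real R"
        by (simp add: u_def v_def flip: diff_divide_distrib)
      then have "cmod (u k - v k) \<le> \<eta> / s / R"
        using ratio[OF k close[OF i]] by simp
      also have "\<dots> \<le> \<eta> / s / 1"
        using R \<eta> s by (intro divide_left_mono) auto
      finally show "cmod (u k - v k) \<le> \<eta> / s" by simp
    qed
    also have "\<dots> \<le> real n * (\<eta> / s)"
      using j \<eta> s by (simp add: mult_right_mono divide_right_mono)
    also have "R ^ (n - 1) * (real n * (\<eta> / s)) \<le> R ^ n * (real n * (\<eta> / s))"
      using R \<eta> s by (intro mult_right_mono power_increasing) auto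
    finally show ?thesis
      using R by (simp add: mult_left_mono)
  qed
  have "\<beta> j = (\<Sum>k<n. coeff l k * ((\<Sum>i<n. \<alpha> i * z i ^ k) + e k))"
    unfolding l_def by (subst vandermonde_inversion[OF inj j, of \<beta>, symmetric]) (simp add: eq)
  also have "\<dots> = (\<Sum>i<n. \<alpha> i * poly l (z i)) + (\<Sum>k<n. coeff l k * e k)"
  proof -
    have "(\<Sum>k<n. coeff l k * (\<Sum>i<n. \<alpha> i * z i ^ k)) = (\<Sum>k<n. \<Sum>i<n. \<alpha> i * (coeff l k * z i ^ k))"
      by (simp add: sum_distrib_left mult_ac)
    also have "\<dots> = (\<Sum>i<n. \<alpha> i * poly l (z i))"
      by (subst sum.swap) (simp add: sum_distrib_left poly_eq_sum_coeff[OF d])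
    finally show ?thesis by (simp add: distrib_left sum.distrib)
  qed
  moreover have "\<alpha> j = (\<Sum>i<n. \<alpha> i * poly l (w i))"
  proof -
    have "(\<Sum>i<n. \<alpha> i * poly l (w i)) = (\<Sum>i<n. if i = j then \<alpha> i else 0)"
      unfolding l_def using inj j by (intro sum.cong) (auto simp: poly_lagrange_node)
    then show ?thesis using j by simp
  qed
  ultimately have "\<beta> j - \<alpha> j =
      (\<Sum>i<n. \<alpha> i * (poly l (z i) - poly l (w i))) + (\<Sum>k<n. coeff l k * e k)"
    by (simp add: right_diff_distrib sum_subtractf)
  then have "cmod (\<alpha> j - \<beta> j) \<le>
      cmod (\<Sum>i<n. \<alpha> i * (poly l (z i) - poly l (w i))) + cmod (\<Sum>k<n. coeff l k * e k)"
    by (metis norm_minus_commute norm_triangle_ineq)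
  also have "cmod (\<Sum>i<n. \<alpha> i * (poly l (z i) - poly l (w i))) \<le>
      (\<Sum>i<n. M * (R ^ n * (real n * (\<eta> / s))))"
  proof (intro sum_norm_le)
    fix i assume "i \<in> {..<n}"
    then show "cmod (\<alpha> i * (poly l (z i) - poly l (w i))) \<le> M * (R ^ n * (real n * (\<eta> / s)))"
      unfolding norm_mult using M diff order.trans[OF norm_ge_zero M] by (intro mult_mono) auto
  qed
  also have "cmod (\<Sum>k<n. coeff l k * e k) \<le> (\<Sum>k<n. cmod (coeff l k) * \<epsilon>)"
    using e by (intro sum_norm_le) (auto simp: norm_mult intro!: mult_left_mono)
  also have "\<dots> = l1_norm l * \<epsilon>"
    by (simp add: l1_norm_eq_sum[OF d] sum_distrib_right)
  also have "\<dots> \<le> (2 / s) ^ (n - 1) * \<epsilon>"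
    unfolding l_def using \<epsilon> l1_norm_lagrange_le[OF s j unit sep] by (intro mult_right_mono) auto
  finally show ?thesis by simp
qed

section \<open>From roots to angles\<close>

text \<open>
  Rotating by \<open>cis (- \<theta>)\<close> moves the problem to a neighbourhood of \<open>1\<close>, where the logarithm is
  Lipschitz with constant \<open>2\<close>; the integer accounts for the branch of the argument.
\<close>

lemma Arg_near_cis:
  assumes close: "cmod (w - cis \<theta>) \<le> \<eta>" and "\<eta> < 1 / 2"
  shows "\<exists>k::int. \<bar>Arg w + 2 * pi * of_int k - \<theta>\<bar> \<le> 2 * \<eta>"
proof -
  define u where "u = w * cis (- \<theta>)"
  have w: "w = u * cis \<theta>"
    by (simp add: u_def mult.assoc cis_mult)
  have "u - 1 = (w - cis \<theta>) * cis (- \<theta>)"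
    by (simp add: u_def left_diff_distrib cis_mult)
  then have u: "cmod (u - 1) \<le> \<eta>"
    using close by (simp add: norm_mult)
  then have Ln_u: "cmod (Ln u) \<le> 2 * \<eta>"
    using norm_Ln_le[of "u - 1"] \<open>\<eta> < 1 / 2\<close> by simp
  have "u \<noteq> 0"
    using u \<open>\<eta> < 1 / 2\<close> by auto
  moreover from this have "w \<noteq> 0"
    by (simp add: w)
  ultimately have "exp (Ln w) = exp (Ln u + \<i> * of_real \<theta>)"
    by (simp add: exp_add w cis_conv_exp)
  then obtain k :: int where "Ln w = Ln u + \<i> * of_real \<theta> + of_int (2 * k) * pi * \<i>"
    unfolding exp_eq by auto
  from arg_cong[OF this, of Im] have "Arg w + 2 * pi * of_int (- k) - \<theta> = Im (Ln u)"
    using \<open>w \<noteq> 0\<close> by (simp add: Arg_eq_Im_Ln)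
  then show ?thesis
    using abs_Im_le_cmod[of "Ln u"] Ln_u by (intro exI[of _ "- k"]) linarith
qed

lemma cmod_cis_diff: "cmod (cis a - cis b) = 2 * \<bar>sin ((a - b) / 2)\<bar>"
proof -
  have "cis a - cis b = cis b * (exp (\<i> * of_real (a - b)) - 1)"
    unfolding cis_conv_exp[symmetric] by (simp add: right_diff_distrib cis_mult)
  then show ?thesis
    by (simp only: norm_mult dist_exp_i_1 norm_cis)
qed

lemma cmod_cis_diff_le: "cmod (cis a - cis b) \<le> \<bar>a - b\<bar>"
  using abs_sin_x_le_abs_x[of "(a - b) / 2"] by (simp add: cmod_cis_diff)

lemma cmod_cis_diff_ge:
  assumes "\<bar>a - b\<bar> \<le> 1"
  shows "\<bar>a - b\<bar> / 2 \<le> cmod (cis a - cis b)"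
proof (rule ccontr)
  assume "\<not> ?thesis"
  then have small: "cmod (cis (a - b) - 1) < \<bar>a - b\<bar> / 2"
    by (simp add: cmod_cis_diff[of a b] cmod_cis_diff[of "a - b" 0, simplified])
  then have "cmod (Ln (1 + (cis (a - b) - 1))) \<le> 2 * cmod (cis (a - b) - 1)"
    using assms by (intro norm_Ln_le) auto
  moreover have "Ln (cis (a - b)) = \<i> * of_real (a - b)"
    unfolding cis_conv_exp using assms pi_gt3 by (intro Ln_exp) auto
  ultimately show False
    using small by (simp add: norm_mult flip: of_real_diff)
qed

section \<open>Aliases on the decimation grid\<close>

lemma card_int_le:
  assumes "\<And>i. i \<in> A \<Longrightarrow> \<bar>real_of_int i\<bar> \<le> b" "0 \<notin> A" "0 \<le> b"
  shows "finite A" "real (card A) \<le> 2 * b"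
proof -
  have sub: "A \<subseteq> {- \<lfloor>b\<rfloor>..\<lfloor>b\<rfloor>} - {0}"
  proof
    fix i assume "i \<in> A"
    then have "real_of_int i \<le> b" "real_of_int (- i) \<le> b" "i \<noteq> 0"
      using assms(1)[of i] assms(2) by auto
    then show "i \<in> {- \<lfloor>b\<rfloor>..\<lfloor>b\<rfloor>} - {0}"
      by (simp add: le_floor_iff)  linarith
  qed
  then show "finite A"
    by (rule finite_subset) simp
  have "card A \<le> card ({- \<lfloor>b\<rfloor>..\<lfloor>b\<rfloor>} - {0})"
    using sub by (intro card_mono) auto
  also have "\<dots> = nat (2 * \<lfloor>b\<rfloor>)"
    using assms(3) by (subst card_Diff_subset) (auto simp: )
  finally have "real (card A) \<le> real (nat (2 * \<lfloor>b\<rfloor>))"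
    by simp
  also have "\<dots> = 2 * real_of_int \<lfloor>b\<rfloor>"
    using assms(3) by simp
  also have "\<dots> \<le> 2 * b"
    by simp
  finally show "real (card A) \<le> 2 * b" .
qed

lemma card_progression_le:
  fixes A :: "nat set" and h :: real
  assumes "0 < h" "0 \<le> d" "\<And>i k. i \<in> A \<Longrightarrow> k \<in> A \<Longrightarrow> real i * h - real k * h \<le> d"
  shows "real (card A) \<le> d / h + 1"
proof (cases "A = {} \<or> infinite A")
  case True
  then show ?thesis using assms by auto
next
  case False
  define a where "a = Min A"
  have "A \<subseteq> {a..a + nat \<lfloor>d / h\<rfloor>}"
  proof
    fix i assume i: "i \<in> A"
    have "a \<in> A" "a \<le> i"
      using False i by (auto simp: a_def)
    then have "real (i - a) * h \<le> d"
      using assms(3)[OF i, of a] by (simp add: left_diff_distrib)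
    then have "real (i - a) \<le> d / h"
      using assms(1) by (simp add: field_simps)
    then have "i - a \<le> nat \<lfloor>d / h\<rfloor>"
      by (simp add: le_nat_floor)
    then show "i \<in> {a..a + nat \<lfloor>d / h\<rfloor>}"
      using \<open>a \<le> i\<close> by auto
  qed
  then have "card A \<le> card {a..a + nat \<lfloor>d / h\<rfloor>}"
    by (intro card_mono) auto
  then have "real (card A) \<le> real (nat \<lfloor>d / h\<rfloor>) + 1"
    by simp
  also have "real (nat \<lfloor>d / h\<rfloor>) \<le> d / h"
    using assms by (simp add: of_nat_floor)
  finally show ?thesis by simp
qed

lemma dpm_grid_eq:
  assumes "L = \<Omega> / (2 * real n - 1)"
  shows "dpm_grid n \<Omega> N = (\<lambda>i. L / 2 + real i * (L / 2 / (real N - 1))) ` {..<N}"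
proof -
  have "1 / 2 * L = L / 2" "L - L / 2 = L / 2" by auto
  then show ?thesis
    unfolding dpm_grid_def Let_def assms[symmetric] by (simp only:)
qed

lemma dpm_grid_bounds:
  assumes "2 \<le> n" "0 < \<Omega>" "l \<in> dpm_grid n \<Omega> N"
  shows "\<Omega> / (2 * real n - 1) / 2 \<le> l" "l \<le> \<Omega> / (2 * real n - 1)" "0 < l"
proof -
  define L where "L = \<Omega> / (2 * real n - 1)"
  have L: "0 < L" using assms by (simp add: L_def)
  obtain i where i: "i < N" "l = L / 2 + real i * (L / 2 / (real N - 1))"
    using assms(3) by (auto simp: dpm_grid_eq[OF L_def])
  define r where "r = real i / (real N - 1)"
  have l: "l = L / 2 + r * (L / 2)"
    by (simp add: i(2) r_def)
  have "0 \<le> r" "r \<le> 1"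
    using i(1) by (auto simp: r_def divide_le_eq)
  then have "0 \<le> r * (L / 2)" "r * (L / 2) \<le> 1 * (L / 2)"
    using L by (auto intro!: mult_right_mono)
  then show "\<Omega> / (2 * real n - 1) / 2 \<le> l" "l \<le> \<Omega> / (2 * real n - 1)" "0 < l"
    using L unfolding l L_def[symmetric] by linarith+
qed

text \<open>
  Since \<open>m\<close> is not zero, \<open>of_int m / l\<close> has modulus at least \<open>1 / L\<close>.  A window of half-width \<open>w\<close>
  around \<open>D\<close> containing it is therefore narrow compared with its distance from \<open>0\<close>, which limits the
  possible \<open>m\<close> and keeps \<open>of_int m / l\<close> itself away from \<open>0\<close>.
\<close>

lemma alias_bounds:
  fixes m :: int and l D w L :: real
  assumes l: "0 < l" "l \<le> L" and m: "m \<noteq> 0" and bad: "\<bar>of_int m / l - D\<bar> \<le> w"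
    and w: "w * L \<le> 1 / 3"
  shows "2 / 3 \<le> L * \<bar>D\<bar>" "w \<le> \<bar>D\<bar> / 2" "\<bar>of_int m\<bar> \<le> 3 / 2 * (L * \<bar>D\<bar>)"
    "\<bar>D\<bar> / 2 \<le> \<bar>of_int m / l\<bar>"
proof -
  have L: "0 < L" using l by simp
  have "1 \<le> \<bar>real_of_int m\<bar>" using m by linarith
  then have "1 / L \<le> \<bar>of_int m\<bar> / l"
    using l by (intro frac_le) auto
  also have "\<dots> \<le> \<bar>D\<bar> + w"
    using bad l by (simp flip: abs_div_pos)
  finally have "1 \<le> L * \<bar>D\<bar> + w * L"
    using L by (simp add: field_simps)
  then show LD: "2 / 3 \<le> L * \<bar>D\<bar>" using w by linarith
  then have "w * L \<le> \<bar>D\<bar> / 2 * L" using w by (simp add: mult.commute)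
  then show wD: "w \<le> \<bar>D\<bar> / 2" using L by simp
  have "\<bar>of_int m / l\<bar> \<le> 3 / 2 * \<bar>D\<bar>"
    using bad wD by linarith
  then have "\<bar>of_int m\<bar> \<le> 3 / 2 * \<bar>D\<bar> * l"
    using l by (simp add: pos_divide_le_eq)
  also have "\<dots> \<le> 3 / 2 * \<bar>D\<bar> * L"
    using l by (intro mult_left_mono) auto
  finally show "\<bar>of_int m\<bar> \<le> 3 / 2 * (L * \<bar>D\<bar>)" by (simp add: mult_ac)
  show "\<bar>D\<bar> / 2 \<le> \<bar>of_int m / l\<bar>"
    using bad wD by linarith
qed

text \<open>
  For fixed \<open>m\<close> the parameter is \<open>l = m / u\<close> with \<open>u\<close> in the window around \<open>D\<close>; so the bad \<open>l\<close> fill an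
  interval whose length is proportional to the width of the window.
\<close>

lemma alias_parameters_close:
  fixes m :: int and l l' D w L :: real
  assumes l: "0 < l" "l \<le> L" "0 < l'" "l' \<le> L" and m: "m \<noteq> 0"
    and bad: "\<bar>of_int m / l - D\<bar> \<le> w" "\<bar>of_int m / l' - D\<bar> \<le> w" and w: "w * L \<le> 1 / 3"
  shows "l - l' \<le> 4 * L * w / \<bar>D\<bar>"
proof -
  define u where "u = of_int m / l"
  define u' where "u' = of_int m / l'"
  have D: "0 < \<bar>D\<bar>"
    using alias_bounds(1)[OF l(1,2) m bad(1) w] by auto
  have "l - l' = l * ((u' - u) / u')"
    using l m by (simp add: u_def u'_def field_simps)
  also have "\<dots> \<le> l * \<bar>(u' - u) / u'\<bar>"
    using l by (intro mult_left_mono abs_ge_self) auto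
  also have "\<dots> = l * (\<bar>u' - u\<bar> / \<bar>u'\<bar>)" by simp
  also have "\<dots> \<le> L * (2 * w / (\<bar>D\<bar> / 2))"
  proof (intro mult_mono frac_le)
    show "\<bar>u' - u\<bar> \<le> 2 * w" using bad unfolding u_def u'_def by linarith
    then show "0 \<le> 2 * w" by linarith
    show "\<bar>D\<bar> / 2 \<le> \<bar>u'\<bar>"
      unfolding u'_def by (rule alias_bounds(4)[OF l(3,4) m bad(2) w])
  qed (use l D in auto)
  finally show ?thesis by (simp add: field_simps)
qed

text \<open>
  Counting bad grid points.  For given \<open>j\<close> at most \<open>3 * L * \<bar>D j\<bar>\<close> integers \<open>m\<close> can matter, and each
  of them spoils the grid points in an interval of length \<open>4 * L * w / \<bar>D j\<bar>\<close>.  In the product the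
  factor \<open>\<bar>D j\<bar>\<close> cancels: the intervals cover a fraction of the grid of order \<open>\<Omega> * \<Delta>\<close>, and one extra
  point for each pair \<open>(j, m)\<close> amounts to at most \<open>2 * \<Omega>\<close> points.  Since the grid has at least
  \<open>7 * \<Omega>\<close> points, some point is never spoiled.
\<close>

lemma grid_avoids_aliases:
  fixes D :: "nat \<Rightarrow> real"
  assumes n: "2 \<le> n" and pos: "0 < \<Omega>" "0 < \<Delta>" and \<kappa>: "\<Omega> * \<Delta> \<le> 1 / 16"
    and N: "N = nat \<lceil>7 * \<Omega>\<rceil>" and D: "\<And>j. j < n \<Longrightarrow> \<bar>D j\<bar> \<le> 1"
  shows "\<exists>l\<in>dpm_grid n \<Omega> N. \<forall>j<n. \<forall>m::int. m \<noteq> 0 \<longrightarrow> \<Delta> / 3 < \<bar>of_int m / l - D j\<bar>"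
proof -
  define L where "L = \<Omega> / (2 * real n - 1)"
  define h where "h = L / 2 / (real N - 1)"
  define f where "f = (\<lambda>i. L / 2 + real i * h)"
  define w where "w = \<Delta> / 3"
  have L: "0 < L" "L \<le> \<Omega> / 3" "real n * L \<le> 2 / 3 * \<Omega>"
    using n pos by (auto simp: L_def field_simps)
  have "w * L \<le> \<Delta> / 3 * (\<Omega> / 3)"
    unfolding w_def using L pos by (intro mult_mono) auto
  then have wL: "w * L \<le> 1 / 3"
    using \<kappa> by (simp add: mult.commute)
  have "0 < w" using pos by (simp add: w_def)
  have N7: "7 * \<Omega> \<le> real N" using pos unfolding N by linarith
  then have "0 < N" using pos by (intro Nat.gr0I) auto
  have grid: "f i \<in> dpm_grid n \<Omega> N" if "i < N" for i
    using that by (auto simp: dpm_grid_eq[OF L_def] f_def h_def)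
  have f: "0 < f i" "f i \<le> L" if "i < N" for i
    using dpm_grid_bounds[OF n pos(1) grid[OF that]] by (auto simp: L_def)
  define bad where "bad = (\<lambda>j (m::int). {i. i < N \<and> \<bar>of_int m / f i - D j\<bar> \<le> w})"
  define M where "M = (\<lambda>j. {m. m \<noteq> 0 \<and> bad j m \<noteq> {}})"
  define U where "U = (\<Union>j<n. \<Union>m\<in>M j. bad j m)"
  have M_le: "\<bar>real_of_int m\<bar> \<le> 3 / 2 * (L * \<bar>D j\<bar>)" if m: "m \<in> M j" for j m
  proof -
    from m obtain i where "m \<noteq> 0" "i < N" "\<bar>of_int m / f i - D j\<bar> \<le> w"
      by (auto simp: M_def bad_def)
    then show ?thesis
      using alias_bounds(3)[OF f(1) f(2) _ _ wL] by blast
  qed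
  have M_0: "0 \<notin> M j" "0 \<le> 3 / 2 * (L * \<bar>D j\<bar>)" for j
    using L by (auto simp: M_def)
  have M: "finite (M j)" "real (card (M j)) \<le> 2 * (3 / 2 * (L * \<bar>D j\<bar>))" for j
    using card_int_le[of "M j" "3 / 2 * (L * \<bar>D j\<bar>)", OF M_le M_0] by blast+
  have "U \<noteq> {..<N}"
  \<comment> \<open>A grid of a single point has no spacing, but then \<open>7 * \<Omega> \<le> 1\<close> and all aliases have modulus
    greater than \<open>1\<close>.\<close>
  proof (cases "N = 1")
    case True
    have "False" if "i \<in> bad j m" "m \<in> M j" "j < n" for i j m
    proof -
      from that have "i < N" "m \<noteq> 0" "\<bar>of_int m / f i - D j\<bar> \<le> w"
        by (auto simp: M_def bad_def)
      then have "2 / 3 \<le> L * \<bar>D j\<bar>"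
        using alias_bounds(1)[OF f(1) f(2) _ _ wL] by blast
      also have "\<dots> \<le> L * 1"
        using D[OF that(3)] L by (intro mult_left_mono) auto
      finally show False using L N7 True by simp
    qed
    then have "U = {}" by (auto simp: U_def)
    then show ?thesis using True by auto
  next
    case False
    then have N2: "2 \<le> N" using \<open>0 < N\<close> by simp
    have h: "0 < h" using L N2 by (simp add: h_def)
    have row: "real (card (\<Union>m\<in>M j. bad j m)) \<le> 12 * L\<^sup>2 * w / h + 3 * L" if j: "j < n" for j
    proof (cases "M j = {}")
      case True
      then show ?thesis using L h \<open>0 < w\<close> by simp
    next
      case ne: False
      define d where "d = 4 * L * w / \<bar>D j\<bar>"
      have "0 \<le> d" using L \<open>0 < w\<close> by (simp add: d_def)
      have "real (card (bad j m)) \<le> d / h + 1" if "m \<in> M j" for m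
      proof (rule card_progression_le[OF h \<open>0 \<le> d\<close>])
        fix i k assume "i \<in> bad j m" "k \<in> bad j m"
        then have "f i - f k \<le> d"
          unfolding d_def using that wL
          by (intro alias_parameters_close[of _ _ _ m] f) (auto simp: bad_def M_def)
        then show "real i * h - real k * h \<le> d" by (simp add: f_def)
      qed
      then have "(\<Sum>m\<in>M j. real (card (bad j m))) \<le> real (card (M j)) * (d / h + 1)"
        by (rule sum_bounded_above)
      moreover have "real (card (\<Union>m\<in>M j. bad j m)) \<le> (\<Sum>m\<in>M j. real (card (bad j m)))"
        using card_UN_le[where I = "M j" and A = "bad j", OF M(1)] by (simp flip: of_nat_sum)
      moreover have "real (card (M j)) * (d / h + 1) \<le> 3 * (L * \<bar>D j\<bar>) * (d / h + 1)"
        using M(2)[of j] \<open>0 \<le> d\<close> h by (intro mult_right_mono) auto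
      moreover have "3 * (L * \<bar>D j\<bar>) * (d / h + 1) \<le> 12 * L\<^sup>2 * w / h + 3 * L"
      proof -
        have "D j \<noteq> 0"
          using M(2)[of j] M(1)[of j] ne card_gt_0_iff[of "M j"] by auto
        then have "\<bar>D j\<bar> * d = 4 * L * w"
          by (simp add: d_def)
        moreover have "3 * (L * \<bar>D j\<bar>) * (d / h + 1) = 3 * L * (\<bar>D j\<bar> * d) / h + 3 * (L * \<bar>D j\<bar>)"
          by (simp add: distrib_left)
        ultimately have "3 * (L * \<bar>D j\<bar>) * (d / h + 1) = 12 * L\<^sup>2 * w / h + 3 * (L * \<bar>D j\<bar>)"
          by (simp add: power2_eq_square)
        moreover have "L * \<bar>D j\<bar> \<le> L * 1"
          using D[OF j] L by (intro mult_left_mono) auto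
        ultimately show ?thesis by simp
      qed
      ultimately show ?thesis by linarith
    qed
    have "real (card U) \<le> (\<Sum>j<n. real (card (\<Union>m\<in>M j. bad j m)))"
      unfolding U_def using card_UN_le[of "{..<n}" "\<lambda>j. \<Union>m\<in>M j. bad j m"] by (simp flip: of_nat_sum)
    also have "\<dots> \<le> real n * (12 * L\<^sup>2 * w / h + 3 * L)"
      using sum_bounded_above[of "{..<n}", OF row] by simp
    also have "\<dots> = (real n * L) * (8 * \<Delta> * (real N - 1)) + 3 * (real n * L)"
    proof -
      have "1 / h = 2 * (real N - 1) / L"
        by (simp add: h_def)
      then have "12 * L\<^sup>2 * w / h = 12 * L * L * w * (2 * (real N - 1) / L)"
        by (simp add: power2_eq_square divide_inverse)
      also have "\<dots> = 8 * L * \<Delta> * (real N - 1)"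
        using L by (simp add: w_def)
      finally show ?thesis by (simp add: distrib_left)
    qed
    also have "\<dots> \<le> (2 / 3 * \<Omega>) * (8 * \<Delta> * (real N - 1)) + 3 * (2 / 3 * \<Omega>)"
      using L pos N2 by (intro add_mono mult_right_mono mult_left_mono) auto
    also have "\<dots> = 16 / 3 * (\<Omega> * \<Delta>) * (real N - 1) + 2 * \<Omega>"
      by simp
    also have "\<dots> \<le> 1 / 3 * (real N - 1) + 2 / 7 * real N"
      using \<kappa> N2 N7 by (intro add_mono mult_right_mono) (auto simp: mult.commute)
    also have "\<dots> < real N"
    proof -
      have "2 \<le> real N" using N2 by simp
      then show ?thesis by (simp add: field_simps)
    qed
    finally have "card U < N" by simp
    then show ?thesis by auto
  qed
  moreover have "U \<subseteq> {..<N}" by (auto simp: U_def bad_def)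
  ultimately obtain i where i: "i < N" "i \<notin> U" by auto
  have "\<Delta> / 3 < \<bar>of_int m / f i - D j\<bar>" if "j < n" "m \<noteq> 0" for j and m :: int
  proof (rule ccontr)
    assume "\<not> ?thesis"
    then have "i \<in> bad j m" using i(1) by (simp add: bad_def w_def)
    then show False using i(2) that unfolding U_def M_def by blast
  qed
  then show ?thesis using grid[OF i(1)] by blast
qed

section \<open>Histogram bins\<close>

lemma hist_bin_bounds:
  assumes "t \<in> hist_bin N i"
  shows "bin_edge N i \<le> t" "t \<le> bin_edge N (Suc i)"
  using assms by (auto simp: hist_bin_def split: if_splits)

lemma bin_edge_mono: "i \<le> k \<Longrightarrow> bin_edge N i \<le> bin_edge N k"
  by (simp add: bin_edge_def divide_right_mono)

lemma bin_edge_Suc: "bin_edge N (Suc i) = bin_edge N i + 1 / real N"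
  by (simp add: bin_edge_def add_divide_distrib)

lemma hist_bin_disjoint:
  assumes "t \<in> hist_bin N i" "t \<in> hist_bin N k" "i < N" "k < N"
  shows "i = k"
proof -
  have "\<not> i < k" if "t \<in> hist_bin N i" "t \<in> hist_bin N k" "k < N" for i k
  proof
    assume "i < k"
    then have "t < bin_edge N (Suc i)"
      using that by (auto simp: hist_bin_def split: if_splits)
    also have "\<dots> \<le> bin_edge N k" using \<open>i < k\<close> by (intro bin_edge_mono) simp
    also have "\<dots> \<le> t" using hist_bin_bounds[OF that(2)] by simp
    finally show False by simp
  qed
  with assms show ?thesis by (metis linorder_neqE_nat)
qed

lemma hist_bin_subset:
  assumes "t \<in> hist_bin N i" "i < N"
  shows "\<bar>t\<bar> \<le> 1 / 2"
proof -
  have "bin_edge N 0 \<le> bin_edge N i" "bin_edge N (Suc i) \<le> bin_edge N N"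
    using assms(2) by (auto intro!: bin_edge_mono)
  moreover have "bin_edge N 0 = - 1 / 2" "bin_edge N N = 1 / 2"
    using assms(2) by (auto simp: bin_edge_def)
  ultimately show ?thesis
    using hist_bin_bounds[OF assms(1)] by linarith
qed

lemma ex_hist_bin_around:
  assumes N: "0 < N" and x: "x \<in> {- 1 / 2..1 / 2}" and d: "0 < d"
    and edges: "\<And>i. i \<le> N \<Longrightarrow> d \<le> \<bar>x - bin_edge N i\<bar>"
  shows "\<exists>i<N. \<forall>t. \<bar>t - x\<bar> < d \<longrightarrow> t \<in> hist_bin N i"
proof -
  define i where "i = nat \<lfloor>(x + 1 / 2) * real N\<rfloor>"
  have "x \<noteq> bin_edge N N" using edges[of N] d by auto
  then have "x < 1 / 2" using x N by (auto simp: bin_edge_def)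
  have nonneg: "0 \<le> (x + 1 / 2) * real N" using x by auto
  then have i: "real i \<le> (x + 1 / 2) * real N" "(x + 1 / 2) * real N < real i + 1"
    unfolding i_def by linarith+
  have "(x + 1 / 2) * real N < 1 * real N"
    using \<open>x < 1 / 2\<close> N by (intro mult_strict_right_mono) auto
  with i have "i < N" by linarith
  have "real i / real N \<le> x + 1 / 2" "x + 1 / 2 < real (Suc i) / real N"
    using i N by (simp_all add: pos_divide_le_eq pos_less_divide_eq)
  then have "bin_edge N i \<le> x" "x < bin_edge N (Suc i)"
    unfolding bin_edge_def by linarith+
  moreover have "d \<le> \<bar>x - bin_edge N i\<bar>" "d \<le> \<bar>x - bin_edge N (Suc i)\<bar>"
    using \<open>i < N\<close> by (auto intro: edges)
  ultimately have "bin_edge N i + d \<le> x" "x \<le> bin_edge N (Suc i) - d"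
    by linarith+
  then have "bin_edge N i \<le> t \<and> t < bin_edge N (Suc i)" if "\<bar>t - x\<bar> < d" for t
    using that by linarith
  then have "t \<in> hist_bin N i" if "\<bar>t - x\<bar> < d" for t
    using that by (auto simp: hist_bin_def less_imp_le)
  then show ?thesis using \<open>i < N\<close> by blast
qed

text \<open>
  Let \<open>t\<^sub>0 l j\<close> be the candidate close to \<open>x j\<close> among the candidates \<open>t\<^sub>0 l j + m / l\<close> found with \<open>l\<close>.
  The nodes lie in different bins, and the alias period \<open>1 / l\<close> is much longer than the cluster and a
  bin, so every \<open>l\<close> puts at most one candidate into a given bin.  A bin containing a node is hit by all
  \<open>l\<close>, because of the distance of the node from the bin edges; any other bin can only be hit by a true
  alias, with \<open>m\<close> not zero, and so is missed by some \<open>l\<close>.  Hence the fullest \<open>n\<close> bins are exactly the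
  bins of the nodes.
\<close>

lemma dpm_selects_true_bins:
  fixes x :: "nat \<Rightarrow> real" and t\<^sub>0 :: "real \<Rightarrow> nat \<Rightarrow> real"
  assumes n: "2 \<le> n" and pos: "0 < \<Omega>" "0 < \<Delta>" "0 < \<tau>" "0 < a" "a < 1 / 6"
    and \<kappa>: "\<Omega> * \<Delta> * (16 + 6 * \<tau>) \<le> 1"
    and Nl: "Nl = nat \<lceil>7 * \<Omega>\<rceil>" and Nb: "Nb = nat \<lceil>3 / \<Delta>\<rceil>"
    and x: "\<And>j. j < n \<Longrightarrow> x j \<in> {- 1 / 2..1 / 2}"
    and sep: "\<And>i k. i < n \<Longrightarrow> k < n \<Longrightarrow> i \<noteq> k \<Longrightarrow> \<Delta> \<le> \<bar>x i - x k\<bar>"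
    and cluster: "\<And>i k. i < n \<Longrightarrow> k < n \<Longrightarrow> \<bar>x i - x k\<bar> \<le> 2 * \<tau> * \<Delta>"
    and edges: "\<And>j i. j < n \<Longrightarrow> i \<le> Nb \<Longrightarrow> a * \<Delta> \<le> \<bar>x j - bin_edge Nb i\<bar>"
    and t\<^sub>0: "\<And>l j. l \<in> dpm_grid n \<Omega> Nl \<Longrightarrow> j < n \<Longrightarrow> \<bar>t\<^sub>0 l j - x j\<bar> \<le> a / 2 * \<Delta>"
    and aliases: "\<And>l. l \<in> dpm_grid n \<Omega> Nl \<Longrightarrow> aliased_solutions n l (Y l) =
      {(l, t) | t. \<exists>j<n. \<exists>m::int. t = t\<^sub>0 l j + of_int m / l \<and> \<bar>t\<bar> \<le> 1 / 2}"
    and B: "largest_bins n Nb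
      (hist_count (\<Union>l\<in>dpm_grid n \<Omega> Nl. aliased_solutions n l (Y l)) Nb) B"
  shows "dpm_Lambda n \<Omega> Nl Nb Y B \<noteq> {}"
    and "\<exists>\<pi>. \<pi> permutes {..<n} \<and> (\<forall>l\<in>dpm_grid n \<Omega> Nl. \<forall>k<n. \<forall>t\<in>hist_bin Nb (B k).
           (l, t) \<in> aliased_solutions n l (Y l) \<longrightarrow> t = t\<^sub>0 l (\<pi> k))"
proof -
  define G where "G = dpm_grid n \<Omega> Nl"
  define S where "S = (\<Union>l\<in>G. aliased_solutions n l (Y l))"
  have Sl: "(l, t) \<in> S \<longleftrightarrow> l \<in> G \<and> (\<exists>j<n. \<exists>m::int. t = t\<^sub>0 l j + of_int m / l \<and> \<bar>t\<bar> \<le> 1 / 2)" for l t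
    using aliases by (auto simp: S_def G_def)
  have Nb3: "3 / \<Delta> \<le> real Nb" using pos unfolding Nb by linarith
  have "0 < 3 / \<Delta>" using pos by simp
  then have Nb0: "0 < Nb" using Nb3 by (intro Nat.gr0I) auto
  have width: "1 / real Nb \<le> \<Delta> / 3"
    using Nb3 Nb0 pos by (simp add: field_simps)
  have bin_width: "\<bar>t - t'\<bar> \<le> \<Delta> / 3" if "t \<in> hist_bin Nb i" "t' \<in> hist_bin Nb i" for t t' i
    using hist_bin_bounds[OF that(1), unfolded bin_edge_Suc]
      hist_bin_bounds[OF that(2), unfolded bin_edge_Suc] width by linarith
  have a12: "a / 2 * \<Delta> \<le> \<Delta> / 12" "a / 2 * \<Delta> < a * \<Delta>"
    using pos by auto
  have near: "\<bar>t\<^sub>0 l j - x j\<bar> \<le> \<Delta> / 12" if "l \<in> G" "j < n" for l j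
    using that unfolding G_def by (rule order.trans[OF t\<^sub>0 a12(1)])

  have "\<forall>j\<in>{..<n}. \<exists>i<Nb. \<forall>t. \<bar>t - x j\<bar> < a * \<Delta> \<longrightarrow> t \<in> hist_bin Nb i"
    using ex_hist_bin_around[OF Nb0 x _ edges] pos by simp
  then obtain b where b: "\<And>j. j < n \<Longrightarrow> b j < Nb"
      "\<And>j t. j < n \<Longrightarrow> \<bar>t - x j\<bar> < a * \<Delta> \<Longrightarrow> t \<in> hist_bin Nb (b j)"
    by (metis lessThan_iff)
  have in_b: "x j \<in> hist_bin Nb (b j)" if "j < n" for j
    using b(2)[OF that, of "x j"] pos by simp
  have t_in_b: "t\<^sub>0 l j \<in> hist_bin Nb (b j)" if "l \<in> G" "j < n" for l j
    by (intro b(2)[OF that(2)] le_less_trans[OF t\<^sub>0 a12(2)]) (use that in \<open>auto simp: G_def\<close>)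
  have t_in_S: "(l, t\<^sub>0 l j) \<in> S" if "l \<in> G" "j < n" for l j
    using that hist_bin_subset[OF t_in_b[OF that] b(1)[OF that(2)]]
    by (auto simp: Sl intro!: exI[of _ j] exI[of _ "0::int"])
  have inj_b: "inj_on b {..<n}"
  proof (rule inj_onI, rule ccontr)
    fix i k assume ik: "i \<in> {..<n}" "k \<in> {..<n}" "b i = b k" "i \<noteq> k"
    then have "x i \<in> hist_bin Nb (b i)" "x k \<in> hist_bin Nb (b i)"
      using in_b[of i] in_b[of k] by auto
    then have "\<bar>x i - x k\<bar> \<le> \<Delta> / 3"
      by (rule bin_width)
    then show False using sep[of i k] ik pos by auto
  qed

  have period: "3 * (16 + 6 * \<tau>) * \<Delta> \<le> 1 / l" if "l \<in> G" for l
  proof -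
    have l: "0 < l" "l \<le> \<Omega> / (2 * real n - 1)"
      using dpm_grid_bounds[OF n pos(1)] that by (auto simp: G_def)
    note l(2)
    also have "\<Omega> / (2 * real n - 1) \<le> \<Omega> / 3"
      using n pos by (intro divide_left_mono) auto
    finally have "l * (3 * (16 + 6 * \<tau>) * \<Delta>) \<le> \<Omega> / 3 * (3 * (16 + 6 * \<tau>) * \<Delta>)"
      using pos by (intro mult_right_mono) auto
    also have "\<dots> = \<Omega> * \<Delta> * (16 + 6 * \<tau>)" by simp
    also note \<kappa>
    finally show ?thesis using l(1) by (simp add: field_simps)
  qed

  \<comment> \<open>At most one candidate per bin: different \<open>m\<close> are a period apart, different \<open>j\<close> almost \<open>\<Delta>\<close>.\<close>
  have unique: "t = t'"
    if tt: "(l, t) \<in> S" "(l, t') \<in> S" "t \<in> hist_bin Nb i" "t' \<in> hist_bin Nb i" for l t t' i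
  proof -
    have l: "l \<in> G" using tt(1) by (simp add: Sl)
    then have l0: "0 < l" using dpm_grid_bounds[OF n pos(1)] by (auto simp: G_def)
    obtain j m where t: "j < n" "t = t\<^sub>0 l j + of_int m / l" using tt(1) by (auto simp: Sl)
    obtain j' m' where t': "j' < n" "t' = t\<^sub>0 l j' + of_int m' / l" using tt(2) by (auto simp: Sl)
    note near = near[OF l t(1)] near[OF l t'(1)]
    note w = bin_width[OF tt(3,4)]
    have "m = m'"
    proof (rule ccontr)
      assume "m \<noteq> m'"
      then have "1 \<le> \<bar>real_of_int m - real_of_int m'\<bar>" by linarith
      then have "1 / l \<le> \<bar>real_of_int m - real_of_int m'\<bar> / l"
        using l0 by (intro divide_right_mono) auto
      also have "\<dots> = \<bar>of_int m / l - of_int m' / l\<bar>"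
        using l0 by (simp flip: diff_divide_distrib)
      finally have "3 * (16 + 6 * \<tau>) * \<Delta> \<le> \<bar>of_int m / l - of_int m' / l\<bar>"
        using period[OF l] by linarith
      moreover have "\<bar>of_int m / l - of_int m' / l\<bar> \<le> \<Delta> / 3 + \<Delta> / 6 + 2 * (\<tau> * \<Delta>)"
        using w near cluster[OF t(1) t'(1)] unfolding t(2) t'(2) by linarith
      moreover have "0 < \<tau> * \<Delta>" using pos by simp
      ultimately show False using pos(2) by (simp add: algebra_simps)
    qed
    then have "\<bar>t\<^sub>0 l j - t\<^sub>0 l j'\<bar> \<le> \<Delta> / 3"
      using w unfolding t(2) t'(2) by simp
    then have "\<bar>x j - x j'\<bar> \<le> \<Delta> / 3 + \<Delta> / 6"
      using near by linarith
    then have "j = j'" using sep[OF t(1) t'(1)] pos by fastforce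
    then show ?thesis using \<open>m = m'\<close> t(2) t'(2) by simp
  qed

  define R where "R = (\<lambda>i. {p \<in> S. snd p \<in> hist_bin Nb i})"
  have finG: "finite G" by (simp add: G_def dpm_grid_def Let_def)
  have R_inj: "inj_on fst (R i)" for i
    using unique by (auto simp: inj_on_def R_def)
  have R_sub: "fst ` R i \<subseteq> G" for i
    by (auto simp: R_def Sl)
  have cnt: "hist_count S Nb i = card (fst ` R i)" for i
    using card_image[OF R_inj, of i] by (simp add: hist_count_def R_def)
  have true_bin: "card G \<le> hist_count S Nb (b j)" if "j < n" for j
  proof -
    have "G \<subseteq> fst ` R (b j)"
      using t_in_S[OF _ that] t_in_b[OF _ that] by (force simp: R_def)
    then show ?thesis
      unfolding cnt by (intro card_mono finite_subset[OF R_sub finG])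
  qed
  have false_bin: "hist_count S Nb i < card G" if i: "i < Nb" "i \<notin> b ` {..<n}" for i
  proof -
    define \<delta> where "\<delta> = 1 / real Nb"
    define c where "c = bin_edge Nb i + \<delta> / 2"
    have \<delta>: "0 \<le> \<delta>" "\<delta> \<le> \<Delta> / 3" "bin_edge Nb (Suc i) = bin_edge Nb i + \<delta>"
      using width by (auto simp: \<delta>_def bin_edge_Suc)
    have center: "\<bar>t - c\<bar> \<le> \<Delta> / 6" if "t \<in> hist_bin Nb i" for t
      using hist_bin_bounds[OF that] \<delta> unfolding c_def by linarith
    have "bin_edge Nb 0 \<le> bin_edge Nb i" "bin_edge Nb (Suc i) \<le> bin_edge Nb Nb"
      using i by (auto intro!: bin_edge_mono)
    moreover have "bin_edge Nb 0 = - 1 / 2" "bin_edge Nb Nb = 1 / 2"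
      using Nb0 by (auto simp: bin_edge_def)
    ultimately have c: "- 1 / 2 \<le> c" "c \<le> 1 / 2"
      using \<delta> unfolding c_def by linarith+
    have D: "\<bar>c - x j\<bar> \<le> 1" if "j < n" for j
    proof -
      have "- 1 / 2 \<le> x j" "x j \<le> 1 / 2" using x[OF that] by auto
      then show ?thesis using c by linarith
    qed
    have "\<Omega> * \<Delta> * 16 \<le> \<Omega> * \<Delta> * (16 + 6 * \<tau>)"
      using pos by (intro mult_left_mono) auto
    then have "\<Omega> * \<Delta> \<le> 1 / 16" using \<kappa> by simp
    from grid_avoids_aliases[where D = "\<lambda>j. c - x j", OF n pos(1,2) this Nl D]
    obtain l where l: "l \<in> G"
      "\<And>j m. j < n \<Longrightarrow> m \<noteq> 0 \<Longrightarrow> \<Delta> / 3 < \<bar>of_int m / l - (c - x j)\<bar>"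
      by (auto simp: G_def)
    have "l \<notin> fst ` R i"
    proof
      assume "l \<in> fst ` R i"
      then obtain t where t: "(l, t) \<in> S" "t \<in> hist_bin Nb i" by (auto simp: R_def)
      then obtain j m where j: "j < n" "t = t\<^sub>0 l j + of_int m / l" by (auto simp: Sl)
      show False
      proof (cases "m = 0")
        case True
        then have "t \<in> hist_bin Nb (b j)" using t_in_b[OF l(1) j(1)] j(2) by simp
        then have "i = b j" by (rule hist_bin_disjoint[OF t(2) _ i(1) b(1)[OF j(1)]])
        then show False using i(2) j(1) by auto
      next
        case False
        have "\<bar>of_int m / l - (c - x j)\<bar> \<le> \<Delta> / 6 + \<Delta> / 12"
          using center[OF t(2)] near[OF l(1) j(1)] unfolding j(2) by linarith
        then show False using l(2)[OF j(1) False] pos(2) by linarith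
      qed
    qed
    then have "fst ` R i \<subset> G" using R_sub l(1) by auto
    then show ?thesis unfolding cnt by (rule psubset_card_mono[OF finG])
  qed

  have B: "inj_on B {..<n}" "B ` {..<n} \<subseteq> {..<Nb}"
    "\<And>k i. k < n \<Longrightarrow> i \<in> {..<Nb} - B ` {..<n} \<Longrightarrow> hist_count S Nb i \<le> hist_count S Nb (B k)"
    using B by (auto simp: largest_bins_def S_def G_def)
  have "B ` {..<n} = b ` {..<n}"
  proof (rule ccontr)
    assume neq: "B ` {..<n} \<noteq> b ` {..<n}"
    have card: "card (B ` {..<n}) = n" "card (b ` {..<n}) = n"
      using B(1) inj_b by (simp_all add: card_image)
    have "\<not> b ` {..<n} \<subseteq> B ` {..<n}" "\<not> B ` {..<n} \<subseteq> b ` {..<n}"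
      using neq card card_subset_eq[of "B ` {..<n}" "b ` {..<n}"]
        card_subset_eq[of "b ` {..<n}" "B ` {..<n}"] by auto
    then obtain j k where "j < n" "b j \<notin> B ` {..<n}" "k < n" "B k \<notin> b ` {..<n}"
      by (auto simp: image_subset_iff)
    note jk = this
    have "hist_count S Nb (b j) \<le> hist_count S Nb (B k)"
      using jk b(1)[of j] by (intro B(3)) auto
    moreover have "B k < Nb"
      using B(2) jk(3) by auto
    ultimately show False
      using true_bin[OF jk(1)] false_bin[OF _ jk(4)] by fastforce
  qed
  then have "B k \<in> b ` {..<n}" if "k < n" for k
    using that by auto
  then have "\<forall>k\<in>{..<n}. \<exists>j. j < n \<and> B k = b j"
    by (auto simp: image_iff)
  from bchoice[OF this] obtain p where "\<forall>k\<in>{..<n}. p k < n \<and> B k = b (p k)"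
    by (rule exE)
  then have p: "\<And>k. k < n \<Longrightarrow> p k < n" "\<And>k. k < n \<Longrightarrow> B k = b (p k)"
    by auto

  have "0 < Nl"
    using pos unfolding Nl by simp
  then have "G \<noteq> {}"
    by (auto simp: G_def dpm_grid_def Let_def)
  moreover have "l \<in> dpm_Lambda n \<Omega> Nl Nb Y B" if "l \<in> G" for l
  proof -
    have "\<exists>t\<in>hist_bin Nb (B k). (l, t) \<in> aliased_solutions n l (Y l)" if k: "k < n" for k
      using t_in_b[OF \<open>l \<in> G\<close> p(1)[OF k]] t_in_S[OF \<open>l \<in> G\<close> p(1)[OF k]] \<open>l \<in> G\<close> p(2)[OF k] aliases
      by (intro bexI[of _ "t\<^sub>0 l (p k)"]) (auto simp: Sl G_def)
    then show ?thesis using that by (auto simp: dpm_Lambda_def G_def)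
  qed
  ultimately show "dpm_Lambda n \<Omega> Nl Nb Y B \<noteq> {}" by blast

  define \<pi> where "\<pi> = (\<lambda>k. if k < n then p k else k)"
  have inj_\<pi>: "inj_on \<pi> {..<n}"
    using B(1) p by (auto simp: inj_on_def \<pi>_def)
  moreover have "\<pi> ` {..<n} = {..<n}"
    using inj_\<pi> p(1) by (intro endo_inj_surj) (auto simp: \<pi>_def)
  ultimately have "bij_betw \<pi> {..<n} {..<n}" by (simp add: bij_betw_def)
  then have "\<pi> permutes {..<n}"
    by (rule bij_imp_permutes) (simp add: \<pi>_def)
  moreover have "t = t\<^sub>0 l (\<pi> k)" if "l \<in> G" "k < n" "t \<in> hist_bin Nb (B k)"
      "(l, t) \<in> aliased_solutions n l (Y l)" for l k t
  proof (rule unique)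
    show "(l, t) \<in> S" using that by (auto simp: S_def)
    show "(l, t\<^sub>0 l (\<pi> k)) \<in> S" using that p(1) by (simp add: \<pi>_def t_in_S)
    show "t \<in> hist_bin Nb (B k)" using that by simp
    show "t\<^sub>0 l (\<pi> k) \<in> hist_bin Nb (B k)" using that p by (simp add: \<pi>_def t_in_b)
  qed
  ultimately show "\<exists>\<pi>. \<pi> permutes {..<n} \<and> (\<forall>l\<in>dpm_grid n \<Omega> Nl. \<forall>k<n. \<forall>t\<in>hist_bin Nb (B k).
           (l, t) \<in> aliased_solutions n l (Y l) \<longrightarrow> t = t\<^sub>0 l (\<pi> k))"
    unfolding G_def by blast
qed

section \<open>Recovery of a single cluster\<close>

lemma min_separation:
  assumes "2 \<le> n" "inj_on x {..<n}"
  shows "0 < min_separation n x"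
    and "\<And>i k. i < n \<Longrightarrow> k < n \<Longrightarrow> i \<noteq> k \<Longrightarrow> min_separation n x \<le> \<bar>x i - x k\<bar>"
proof -
  let ?A = "{\<bar>x s - x k\<bar> | s k. s < n \<and> k < n \<and> s \<noteq> k}"
  have "?A \<subseteq> (\<lambda>(s, k). \<bar>x s - x k\<bar>) ` ({..<n} \<times> {..<n})"
    by auto
  then have fin: "finite ?A"
    by (rule finite_subset) simp
  then show "min_separation n x \<le> \<bar>x i - x k\<bar>" if "i < n" "k < n" "i \<noteq> k" for i k
    unfolding min_separation_def using that by (intro Min_le) auto
  have "\<bar>x 0 - x 1\<bar> \<in> ?A"
    using assms(1) by (intro CollectI exI[of _ "0::nat"] exI[of _ "1::nat"]) auto
  then have "Min ?A \<in> ?A"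
    using fin by (intro Min_in) auto
  then show "0 < min_separation n x"
    unfolding min_separation_def using inj_onD[OF assms(2)] by force
qed

lemma vandermonde_least_squares_exact:
  assumes inj: "inj_on w {..<n}" and k: "k < n"
    and u: "least_squares_solution (mat n n (\<lambda>(k, j). w j ^ k)) (vec n b) u"
  shows "(\<Sum>j<n. u $ j * w j ^ k) = b k"
proof -
  let ?V = "mat n n (\<lambda>(k, j). w j ^ k)"
  have Vv: "(?V *\<^sub>v v) $ k = (\<Sum>j<n. v $ j * w j ^ k)" if "v \<in> carrier_vec n" "k < n" for v k
    using that by (auto simp: scalar_prod_def atLeast0LessThan mult.commute intro!: sum.cong)
  have ker: "v = 0\<^sub>v n" if v: "v \<in> carrier_vec n" "?V *\<^sub>v v = 0\<^sub>v n" for v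
  proof -
    have "v $ j = 0" if "j < n" for j
    proof -
      have "(\<Sum>i<n. v $ i * w i ^ k) = 0" if "k < n" for k
        using Vv[OF v(1) that] v(2) that by simp
      then show ?thesis
        using vandermonde_inversion[OF inj that, of "\<lambda>i. v $ i"] by simp
    qed
    then show ?thesis using v(1) by (auto simp: vec_eq_iff)
  qed
  have V: "?V \<in> carrier_mat n n" "vec n b \<in> carrier_vec n" by auto
  note exact = least_squares_exact[OF V ker u]
  show ?thesis
    using Vv[OF exact(1) k] exact(2) k by simp
qed

lemma exp_eq_cis_power:
  "exp (2 * of_real pi * \<i> * of_real t * of_nat k * of_real l) = cis (2 * pi * t * l) ^ k"
  by (simp add: cis_conv_exp mult_ac flip: exp_of_nat_mult)

text \<open>
  Permuting the roots, or shifting an angle by full turns, does not change the set of candidates, so the matching of the roots with the nodes and the branch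
  of the argument can both be absorbed into the choice of the representatives \<open>t\<^sub>0\<close>.
\<close>

lemma prony_nodes_aliases:
  fixes x :: "nat \<Rightarrow> real" and \<alpha> e m :: "nat \<Rightarrow> complex" and s \<mu> \<epsilon> l :: real
  assumes n: "0 < n" and s: "0 < s" "s \<le> 1" and \<mu>: "0 < \<mu>" and \<epsilon>: "0 \<le> \<epsilon>" and l: "0 < l"
    and sep: "\<And>i k. i < n \<Longrightarrow> k < n \<Longrightarrow> i \<noteq> k \<Longrightarrow>
      s \<le> cmod (cis (2 * pi * x i * l) - cis (2 * pi * x k * l))"
    and amp: "\<And>i. i < n \<Longrightarrow> \<mu> \<le> cmod (\<alpha> i)"
    and m: "\<And>k. k < 2 * n \<Longrightarrow> m k = (\<Sum>j<n. \<alpha> j * cis (2 * pi * x j * l) ^ k) + e k"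
    and e: "\<And>k. k < 2 * n \<Longrightarrow> cmod (e k) \<le> \<epsilon>"
    and small: "\<epsilon> < \<mu> * s ^ (2 * n - 1) / 16 ^ n"
    and \<eta>: "\<eta> = 8 ^ n * \<epsilon> / (\<mu> * s ^ (2 * n - 2))" "\<eta> < 1 / 2"
    and Y: "prony_nodes n m Y"
  shows "\<exists>t\<^sub>0. (\<forall>j<n. \<bar>t\<^sub>0 j - x j\<bar> \<le> \<eta> / (pi * l)) \<and>
      aliased_solutions n l Y =
        {(l, t) | t. \<exists>j<n. \<exists>m::int. t = t\<^sub>0 j + of_int m / l \<and> \<bar>t\<bar> \<le> 1 / 2}"
proof -
  from Y obtain q w where q:
      "least_squares_solution (hankel n m) (- vec n (\<lambda>k. m (n + k))) q"
      "monic_poly n q = (\<Prod>k<n. [:- w k, 1:])" and Y: "\<And>k. k < n \<Longrightarrow> Y k = Arg (w k) / (2 * pi)"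
    by (auto simp: prony_nodes_def)
  obtain \<sigma> where \<sigma>: "\<sigma> permutes {..<n}"
      "\<And>j. j < n \<Longrightarrow> cmod (cis (2 * pi * x j * l) - w (\<sigma> j)) \<le> \<eta>"
    using prony_roots_error[OF n s \<mu> \<epsilon> _ sep amp m e small q] \<eta>(1) by auto
  have \<sigma>_less: "\<sigma> j < n \<longleftrightarrow> j < n" for j
    using permutes_in_image[OF \<sigma>(1), of j] by simp
  have "\<exists>k::int. \<bar>Arg (w (\<sigma> j)) + 2 * pi * of_int k - 2 * pi * x j * l\<bar> \<le> 2 * \<eta>" if "j < n" for j
    using \<sigma>(2)[OF that] \<eta>(2) by (intro Arg_near_cis) (simp_all add: norm_minus_commute)
  then obtain k :: "nat \<Rightarrow> int" where
    k: "\<And>j. j < n \<Longrightarrow> \<bar>Arg (w (\<sigma> j)) + 2 * pi * of_int (k j) - 2 * pi * x j * l\<bar> \<le> 2 * \<eta>"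
    by metis
  define t\<^sub>0 where "t\<^sub>0 = (\<lambda>j. (Y (\<sigma> j) + of_int (k j)) / l)"
  have "\<bar>t\<^sub>0 j - x j\<bar> \<le> \<eta> / (pi * l)" if j: "j < n" for j
  proof -
    have "t\<^sub>0 j - x j = (Arg (w (\<sigma> j)) + 2 * pi * of_int (k j) - 2 * pi * x j * l) / (2 * pi * l)"
      using l j by (simp add: t\<^sub>0_def Y \<sigma>_less field_simps)
    then have "\<bar>t\<^sub>0 j - x j\<bar> = \<bar>Arg (w (\<sigma> j)) + 2 * pi * of_int (k j) - 2 * pi * x j * l\<bar> / (2 * pi * l)"
      using l by (simp only: abs_divide abs_of_pos[of "2 * pi * l"] mult_pos_pos pi_gt_zero zero_less_numeral)
    also have "\<dots> \<le> 2 * \<eta> / (2 * pi * l)"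
      using k[OF j] l by (intro divide_right_mono) auto
    finally show ?thesis by simp
  qed
  moreover have "aliased_solutions n l Y =
      {(l, t) | t. \<exists>j<n. \<exists>m::int. t = t\<^sub>0 j + of_int m / l \<and> \<bar>t\<bar> \<le> 1 / 2}"
  proof -
    have "(\<exists>i<n. \<exists>m::int. t = (Y i + of_int m) / l) \<longleftrightarrow> (\<exists>j<n. \<exists>m::int. t = t\<^sub>0 j + of_int m / l)"
      (is "?L \<longleftrightarrow> ?R") for t
    proof
      assume ?L
      then obtain i m where i: "i < n" "t = (Y i + of_int m) / l" by auto
      define j where "j = inv_into UNIV \<sigma> i"
      have j: "\<sigma> j = i" "j < n"
        using permutes_inverses(1)[OF \<sigma>(1), of i] \<sigma>_less[of j] i(1) by (auto simp: j_def)
      then have "t = t\<^sub>0 j + of_int (m - k j) / l"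
        using i(2) by (simp add: t\<^sub>0_def add_divide_distrib diff_divide_distrib)
      then show ?R using j(2) by blast
    next
      assume ?R
      then obtain j m where j: "j < n" "t = t\<^sub>0 j + of_int m / l" by auto
      then have "t = (Y (\<sigma> j) + of_int (k j + m)) / l"
        by (simp add: t\<^sub>0_def add_divide_distrib)
      then show ?L using j(1) \<sigma>_less by blast
    qed
    then show ?thesis
      unfolding aliased_solutions_def by blast
  qed
  ultimately show ?thesis by blast
qed

text \<open>
  The constants are explicit versions of the smallness assumptions: the bound on \<open>\<Omega> * \<Delta>\<close> keeps the
  cluster within an arc of length at most \<open>1\<close> for all grid parameters, and the noise bound is the one
  required by Prony's method for nodes of separation \<open>\<Omega> * \<Delta> / (2 * real n)\<close>, with room for the bin
  margin \<open>a * \<Delta>\<close>.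
\<close>

locale cluster_problem =
  fixes n :: nat and \<Omega> \<Delta> \<tau> a \<mu> \<epsilon> :: real
    and x :: "nat \<Rightarrow> real" and \<alpha> :: "nat \<Rightarrow> complex" and e g :: "real \<Rightarrow> complex"
  assumes n: "2 \<le> n" and \<Omega>: "0 < \<Omega>" and \<Delta>: "0 < \<Delta>" and \<tau>: "0 < \<tau>" and \<mu>: "0 < \<mu>"
    and a: "0 < a" "a < 1 / 6" and \<epsilon>: "0 \<le> \<epsilon>"
    and srf_large: "\<Omega> * \<Delta> * (16 + 6 * \<tau>) \<le> 1"
    and noise: "\<epsilon> \<le> \<mu> * (a / 2) / (16 ^ n * (2 * real n) ^ (2 * n - 1)) * (\<Omega> * \<Delta>) ^ (2 * n - 1)"
    and sep: "\<And>i k. i < n \<Longrightarrow> k < n \<Longrightarrow> i \<noteq> k \<Longrightarrow> \<Delta> \<le> \<bar>x i - x k\<bar>"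
    and cluster: "\<And>i k. i < n \<Longrightarrow> k < n \<Longrightarrow> \<bar>x i - x k\<bar> \<le> 2 * \<tau> * \<Delta>"
    and amp: "\<And>i. i < n \<Longrightarrow> \<mu> \<le> cmod (\<alpha> i)"
    and e: "\<And>\<omega>. \<omega> \<in> {- \<Omega>..\<Omega>} \<Longrightarrow> cmod (e \<omega>) \<le> \<epsilon>"
    and g: "\<And>\<omega>. \<omega> \<in> {- \<Omega>..\<Omega>} \<Longrightarrow>
      g \<omega> = (\<Sum>k<n. \<alpha> k * exp (2 * of_real pi * \<i> * of_real (x k) * of_real \<omega>)) + e \<omega>"
begin

text \<open>
  A lower bound, uniform over the grid, for the distances of the nodes on the unit circle.
\<close>

definition s :: real where "s = \<Omega> * \<Delta> / (2 * real n)"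

text \<open>
  The resulting bound for the errors of the roots in Prony's method.
\<close>

definition \<eta> :: real where "\<eta> = 8 ^ n * \<epsilon> / (\<mu> * s ^ (2 * n - 2))"

lemma s_pos: "0 < s"
  using n \<Omega> \<Delta> by (simp add: s_def)

lemma \<Omega>\<Delta>_eq: "\<Omega> * \<Delta> = 2 * real n * s"
  using n by (simp add: s_def)

lemma \<Omega>\<Delta>_\<tau>: "\<Omega> * \<Delta> * \<tau> \<le> 1 / 6" and \<Omega>\<Delta>_le: "\<Omega> * \<Delta> \<le> 1 / 16"
proof -
  have "0 < \<Omega> * \<Delta>" "0 < \<Omega> * \<Delta> * \<tau>"
    using \<Omega> \<Delta> \<tau> by auto
  then show "\<Omega> * \<Delta> * \<tau> \<le> 1 / 6" "\<Omega> * \<Delta> \<le> 1 / 16"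
    using srf_large by (simp_all add: distrib_left)
qed

lemma s_le_1: "s \<le> 1"
proof -
  have "1 * s \<le> 2 * real n * s"
    using n s_pos by (intro mult_right_mono) auto
  then show ?thesis using \<Omega>\<Delta>_le \<Omega>\<Delta>_eq by simp
qed

lemma noise_le: "\<epsilon> \<le> \<mu> * (a / 2) * s ^ (2 * n - 1) / 16 ^ n"
  using noise n unfolding \<Omega>\<Delta>_eq by (simp add: power_mult_distrib)

lemma noise_less: "\<epsilon> < \<mu> * s ^ (2 * n - 1) / 16 ^ n"
proof -
  note noise_le
  also have "\<mu> * (a / 2) * s ^ (2 * n - 1) / 16 ^ n < \<mu> * 1 * s ^ (2 * n - 1) / 16 ^ n"
    using \<mu> a s_pos
    by (intro divide_strict_right_mono mult_strict_right_mono mult_strict_left_mono zero_less_power) auto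
  finally show ?thesis by simp
qed

lemma s_pow_Suc: "s ^ (2 * n - 1) = s ^ (2 * n - 2) * s"
proof -
  have "2 * n - 1 = Suc (2 * n - 2)" using n by simp
  then show ?thesis by (simp only: power_Suc2)
qed

lemma \<eta>_nonneg: "0 \<le> \<eta>"
  using \<mu> s_pos \<epsilon> by (simp add: \<eta>_def)

lemma \<eta>_le: "\<eta> \<le> a / 2 * s"
proof -
  have p: "0 < s ^ (2 * n - 2)" using s_pos by simp
  have "(8::real) ^ n \<le> 16 ^ n" by (intro power_mono) auto
  then have "8 ^ n * \<epsilon> \<le> 16 ^ n * \<epsilon>"
    using \<epsilon> by (intro mult_right_mono) auto
  also have "\<dots> \<le> 16 ^ n * (\<mu> * (a / 2) * s ^ (2 * n - 1) / 16 ^ n)"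
    using noise_le by (intro mult_left_mono) auto
  also have "\<dots> = a / 2 * s * (\<mu> * s ^ (2 * n - 2))"
    unfolding s_pow_Suc by simp
  finally show ?thesis
    unfolding \<eta>_def using \<mu> p by (subst pos_divide_le_eq) auto
qed

lemma \<eta>_le_s: "\<eta> \<le> s / 12"
proof -
  have "a / 2 * s \<le> 1 / 12 * s"
    using a s_pos by (intro mult_right_mono) auto
  then show ?thesis using \<eta>_le by simp
qed

context
  fixes N :: nat and l :: real
  assumes l: "l \<in> dpm_grid n \<Omega> N"
begin

lemma l_pos: "0 < l" and l_le: "l * (2 * real n - 1) \<le> \<Omega>" and l_ge: "\<Omega> \<le> 2 * l * (2 * real n - 1)"
  using dpm_grid_bounds[OF n \<Omega> l] n by (auto simp: field_simps)

lemma angle_spread: "i < n \<Longrightarrow> k < n \<Longrightarrow> \<bar>2 * pi * x i * l - 2 * pi * x k * l\<bar> \<le> 16 * (real n * \<tau> * s)"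
  and angle_spread_le_1: "i < n \<Longrightarrow> k < n \<Longrightarrow> \<bar>2 * pi * x i * l - 2 * pi * x k * l\<bar> \<le> 1"
proof -
  assume ik: "i < n" "k < n"
  have "l * 3 \<le> l * (2 * real n - 1)"
    using n l_pos by (intro mult_left_mono) auto
  then have l3: "l * 3 \<le> \<Omega>" using l_le by linarith
  have "\<bar>2 * pi * x i * l - 2 * pi * x k * l\<bar> = 2 * pi * l * \<bar>x i - x k\<bar>"
    using l_pos by (simp add: abs_mult flip: right_diff_distrib left_diff_distrib)
  also have "\<dots> \<le> 2 * 4 * l * (2 * \<tau> * \<Delta>)"
    using cluster[OF ik] l_pos pi_less_4 by (intro mult_mono) auto
  also have "\<dots> = 16 / 3 * (l * 3 * (\<tau> * \<Delta>))"
    by simp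
  also have "\<dots> \<le> 16 / 3 * (\<Omega> * (\<tau> * \<Delta>))"
    using l3 \<tau> \<Delta> by (intro mult_left_mono mult_right_mono) auto
  also have "\<dots> = 16 / 3 * (\<Omega> * \<Delta> * \<tau>)" by simp
  finally have *: "\<bar>2 * pi * x i * l - 2 * pi * x k * l\<bar> \<le> 16 / 3 * (\<Omega> * \<Delta> * \<tau>)" .
  then show "\<bar>2 * pi * x i * l - 2 * pi * x k * l\<bar> \<le> 1"
    using \<Omega>\<Delta>_\<tau> by linarith
  have "0 < real n * \<tau> * s" using n \<tau> s_pos by simp
  with * show "\<bar>2 * pi * x i * l - 2 * pi * x k * l\<bar> \<le> 16 * (real n * \<tau> * s)"
    unfolding \<Omega>\<Delta>_eq by (simp add: mult_ac)
qed

lemma s_le_pi_l_\<Delta>: "s \<le> pi * l * \<Delta>"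
proof -
  have "\<Omega> * \<Delta> \<le> 2 * l * (2 * real n - 1) * \<Delta>"
    using l_ge \<Delta> by (intro mult_right_mono) auto
  also have "\<dots> \<le> 2 * l * (2 * real n) * \<Delta>"
    using l_pos \<Delta> by (intro mult_right_mono mult_left_mono) auto
  finally have "s \<le> 2 * l * \<Delta>"
    unfolding s_def using n by (simp add: field_simps)
  also have "\<dots> \<le> pi * l * \<Delta>"
    using l_pos \<Delta> pi_gt3 by (intro mult_right_mono) auto
  finally show ?thesis .
qed

lemma circle_separation:
  assumes "i < n" "k < n" "i \<noteq> k"
  shows "s \<le> cmod (cis (2 * pi * x i * l) - cis (2 * pi * x k * l))"
proof -
  have "s \<le> pi * l * \<Delta>" by (rule s_le_pi_l_\<Delta>)
  also have "\<dots> \<le> pi * l * \<bar>x i - x k\<bar>"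
    using sep[OF assms] l_pos by (intro mult_left_mono) auto
  also have "\<dots> = \<bar>2 * pi * x i * l - 2 * pi * x k * l\<bar> / 2"
    using l_pos by (simp add: abs_mult flip: right_diff_distrib left_diff_distrib)
  also have "\<dots> \<le> cmod (cis (2 * pi * x i * l) - cis (2 * pi * x k * l))"
    using angle_spread_le_1[OF assms(1,2)] by (rule cmod_cis_diff_ge)
  finally show ?thesis .
qed

lemma sample:
  assumes "k < 2 * n"
  shows "g (l * real k) = (\<Sum>j<n. \<alpha> j * cis (2 * pi * x j * l) ^ k) + e (l * real k)"
    and "cmod (e (l * real k)) \<le> \<epsilon>"
proof -
  have "l * real k \<le> l * (2 * real n - 1)"
    using assms l_pos by (intro mult_left_mono) auto
  then have "l * real k \<le> \<Omega>"
    using l_le by (rule order.trans)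
  moreover have "0 \<le> l * real k"
    using l_pos by simp
  ultimately have in_range: "l * real k \<in> {- \<Omega>..\<Omega>}"
    using \<Omega> by auto
  then show "cmod (e (l * real k)) \<le> \<epsilon>" by (rule e)
  show "g (l * real k) = (\<Sum>j<n. \<alpha> j * cis (2 * pi * x j * l) ^ k) + e (l * real k)"
    unfolding g[OF in_range] exp_eq_cis_power[symmetric] by (simp add: mult_ac)
qed

lemma ex_node_representatives:
  assumes "prony_nodes n (\<lambda>k. g (l * real k)) Y"
  shows "\<exists>t\<^sub>0. (\<forall>j<n. \<bar>t\<^sub>0 j - x j\<bar> \<le> \<eta> / (pi * l)) \<and>
      aliased_solutions n l Y =
        {(l, t) | t. \<exists>j<n. \<exists>m::int. t = t\<^sub>0 j + of_int m / l \<and> \<bar>t\<bar> \<le> 1 / 2}"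
proof (rule prony_nodes_aliases[where e = "\<lambda>k. e (l * real k)"])
  show "\<eta> < 1 / 2" using \<eta>_le_s s_le_1 by simp
qed (use n s_pos s_le_1 \<mu> \<epsilon> l_pos circle_separation amp sample noise_less assms in
      \<open>auto simp: \<eta>_def\<close>)

text \<open>
  An error \<open>\<eta>\<close> on the circle is an error \<open>\<eta> / (pi * l)\<close> of the node, so the candidates stay within the
  bins of the nodes, with half of the margin to spare.
\<close>

lemma node_error_le_bin_margin: "\<eta> / (pi * l) \<le> a / 2 * \<Delta>"
proof -
  have "\<eta> \<le> a / 2 * s" by (rule \<eta>_le)
  also have "\<dots> \<le> a / 2 * (pi * l * \<Delta>)"
    using s_le_pi_l_\<Delta> a by (intro mult_left_mono) auto
  finally show ?thesis
    using l_pos by (subst pos_divide_le_eq) (auto simp: mult_ac)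
qed

lemma node_error_le:
  "\<eta> / (pi * l) \<le> 8 ^ n * (2 * real n) ^ (2 * n - 2) * (4 * real n) / \<mu> * srf \<Omega> \<Delta> ^ (2 * n - 2) * (\<epsilon> / \<Omega>)"
proof -
  have "\<Omega> \<le> 2 * l * (2 * real n - 1)" by (rule l_ge)
  also have "\<dots> \<le> 2 * l * (2 * real n)"
    using l_pos by (intro mult_left_mono) auto
  also have "\<dots> \<le> pi * l * (4 * real n)"
    using l_pos pi_gt3 n by (simp add: mult_ac)
  finally have "1 / (pi * l) \<le> 4 * real n / \<Omega>"
    using l_pos \<Omega> by (simp add: field_simps)
  then have "\<eta> * (1 / (pi * l)) \<le> \<eta> * (4 * real n / \<Omega>)"
    using \<eta>_nonneg by (intro mult_left_mono) auto
  then have "\<eta> / (pi * l) \<le> \<eta> * (4 * real n / \<Omega>)"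
    by simp
  also have "\<dots> = 8 ^ n * (2 * real n) ^ (2 * n - 2) * (4 * real n) / \<mu> * srf \<Omega> \<Delta> ^ (2 * n - 2) * (\<epsilon> / \<Omega>)"
    by (simp add: \<eta>_def s_def srf_def power_divide mult_ac)
  finally show ?thesis .
qed

lemma amplitude_estimate_error:
  fixes x' :: "nat \<Rightarrow> real" and u :: "complex vec"
  assumes x': "\<And>j. j < n \<Longrightarrow> \<bar>x' (\<sigma> j) - x j\<bar> \<le> \<eta> / (pi * l)" and \<sigma>: "\<sigma> permutes {..<n}"
    and u: "least_squares_solution
          (mat n n (\<lambda>(k, j). exp (2 * of_real pi * \<i> * of_real (x' j) * of_nat k * of_real l)))
          (vec n (\<lambda>k. g (l * real k))) u"
    and M: "\<And>i. i < n \<Longrightarrow> cmod (\<alpha> i) \<le> M" and j: "j < n"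
  shows "cmod (\<alpha> j - u $ \<sigma> j) \<le>
    (real n * (M * ((64 * \<tau> * real n + 2) ^ n * (real n * (4 * 8 ^ n / \<mu>)))) + 4 ^ n) *
      (2 * real n) ^ (2 * n - 1) * srf \<Omega> \<Delta> ^ (2 * n - 1) * \<epsilon>"
proof -
  \<comment> \<open>Bounds the diameter of the cluster on the circle in units of \<open>s / 2\<close>, the separation that is
    guaranteed for the estimated nodes.\<close>
  define R where "R = 64 * \<tau> * real n + 2"
  define z where "z = (\<lambda>i. cis (2 * pi * x i * l))"
  define v where "v = (\<lambda>i. cis (2 * pi * x' i * l))"
  define w where "w = (\<lambda>i. v (\<sigma> i))"
  have R: "1 \<le> R" using \<tau> by (simp add: R_def)
  have close: "cmod (z i - w i) \<le> 2 * \<eta>" if "i < n" for i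
  proof -
    have "cmod (z i - w i) \<le> \<bar>2 * pi * x i * l - 2 * pi * x' (\<sigma> i) * l\<bar>"
      unfolding z_def w_def v_def by (rule cmod_cis_diff_le)
    also have "\<dots> = 2 * pi * l * \<bar>x' (\<sigma> i) - x i\<bar>"
      using l_pos by (simp add: abs_mult abs_minus_commute flip: right_diff_distrib left_diff_distrib)
    also have "\<dots> \<le> 2 * pi * l * (\<eta> / (pi * l))"
      using x'[OF that] l_pos by (intro mult_left_mono) auto
    finally show ?thesis using l_pos by simp
  qed
  have zz: "cmod (z i - z k) \<le> 16 * (real n * \<tau> * s)" if "i < n" "k < n" for i k
    using cmod_cis_diff_le angle_spread[OF that] unfolding z_def by (rule order.trans)
  have tri: "cmod (z i - w k) \<le> cmod (z i - z k) + 2 * \<eta>"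
    "cmod (w i - w k) \<le> cmod (z i - z k) + 4 * \<eta>"
    "cmod (z i - z k) \<le> cmod (w i - w k) + 4 * \<eta>" if "i < n" "k < n" for i k
    using close[OF that(1)] close[OF that(2)] by norm+
  have sep_w: "s / 2 \<le> cmod (w i - w k)" if "i < n" "k < n" "i \<noteq> k" for i k
    using circle_separation[OF that] tri(3)[OF that(1,2)] \<eta>_le_s s_pos unfolding z_def by linarith
  have diam: "16 * (real n * \<tau> * s) + 4 * \<eta> \<le> R * (s / 2)"
  proof -
    have "0 < real n * \<tau> * s" using n \<tau> s_pos by simp
    moreover have "R * (s / 2) = 32 * (real n * \<tau> * s) + s"
      by (simp add: R_def algebra_simps)
    ultimately show ?thesis using \<eta>_le_s s_pos by linarith
  qed
  have inj_w: "inj_on w {..<n}"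
    using sep_w s_pos by (intro inj_onI) force
  have inj_v: "inj_on v {..<n}"
  proof -
    have "inj_on (v \<circ> \<sigma>) {..<n}" using inj_w by (simp add: w_def comp_def)
    then have "inj_on v (\<sigma> ` {..<n})" by (rule inj_on_imageI)
    then show ?thesis using permutes_image[OF \<sigma>] by simp
  qed
  have u': "least_squares_solution (mat n n (\<lambda>(k, j). v j ^ k)) (vec n (\<lambda>k. g (l * real k))) u"
    using u by (simp only: exp_eq_cis_power v_def)
  have eq: "(\<Sum>i<n. u $ \<sigma> i * w i ^ k) = (\<Sum>i<n. \<alpha> i * z i ^ k) + e (l * real k)" if "k < n" for k
  proof -
    have "(\<Sum>i<n. u $ \<sigma> i * w i ^ k) = (\<Sum>i<n. u $ i * v i ^ k)"
      unfolding w_def using sum.permute[OF \<sigma>, of "\<lambda>i. u $ i * v i ^ k"] by (simp add: comp_def)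
    then show ?thesis
      using vandermonde_least_squares_exact[OF inj_v that u'] sample(1)[of k] that by (simp add: z_def)
  qed
  have "cmod (\<alpha> j - u $ \<sigma> j) \<le>
      real n * (M * (R ^ n * (real n * (2 * \<eta> / (s / 2))))) + (2 / (s / 2)) ^ (n - 1) * \<epsilon>"
  proof (rule amplitude_error[where z = z and w = w and e = "\<lambda>k. e (l * real k)"
      and \<beta> = "\<lambda>i. u $ \<sigma> i"])
    show "cmod (z i - w k) \<le> R * (s / 2)" "cmod (w i - w k) \<le> R * (s / 2)" if "i < n" "k < n" for i k
      using tri(1,2)[OF that] zz[OF that] diam \<eta>_nonneg by linarith+
    show "cmod (e (l * real k)) \<le> \<epsilon>" if "k < n" for k
      using sample(2)[of k] that by simp
  qed (use s_pos R \<epsilon> \<eta>_nonneg j close sep_w M eq in \<open>auto simp: w_def v_def\<close>)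
  also have "2 * \<eta> / (s / 2) = 4 * 8 ^ n / \<mu> * (\<epsilon> / s ^ (2 * n - 1))"
    using s_pos unfolding \<eta>_def s_pow_Suc by (simp add: mult_ac)
  also have "real n * (M * (R ^ n * (real n * (4 * 8 ^ n / \<mu> * (\<epsilon> / s ^ (2 * n - 1)))))) =
      real n * (M * (R ^ n * (real n * (4 * 8 ^ n / \<mu>)))) * (\<epsilon> / s ^ (2 * n - 1))"
    by (simp only: mult.assoc)
  also have "(2 / (s / 2)) ^ (n - 1) * \<epsilon> \<le> 4 ^ n * (\<epsilon> / s ^ (2 * n - 1))"
  proof -
    have "s ^ (2 * n - 1) \<le> s ^ (n - 1)"
      using s_pos s_le_1 by (intro power_decreasing) auto
    then have "4 ^ (n - 1) / s ^ (n - 1) \<le> 4 ^ n / s ^ (2 * n - 1)"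
      using s_pos by (intro frac_le) (auto intro: power_increasing)
    then have "4 ^ (n - 1) / s ^ (n - 1) * \<epsilon> \<le> 4 ^ n / s ^ (2 * n - 1) * \<epsilon>"
      using \<epsilon> by (intro mult_right_mono) auto
    then show ?thesis by (simp add: power_divide)
  qed
  also have "real n * (M * (R ^ n * (real n * (4 * 8 ^ n / \<mu>)))) * (\<epsilon> / s ^ (2 * n - 1))
      + 4 ^ n * (\<epsilon> / s ^ (2 * n - 1)) =
    (real n * (M * (R ^ n * (real n * (4 * 8 ^ n / \<mu>)))) + 4 ^ n) * (\<epsilon> / s ^ (2 * n - 1))"
    by (simp only: distrib_right)
  also have "\<epsilon> / s ^ (2 * n - 1) = (2 * real n) ^ (2 * n - 1) * srf \<Omega> \<Delta> ^ (2 * n - 1) * \<epsilon>"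
    by (simp add: s_def srf_def power_divide)
  finally show ?thesis by (simp add: R_def mult.assoc)
qed

end

lemma dpm_recovers:
  assumes x: "x ` {..<n} \<subseteq> {- 1 / 2..1 / 2}"
    and Nl: "Nl = nat \<lceil>7 * \<Omega>\<rceil>" and Nb: "Nb = nat \<lceil>3 / \<Delta>\<rceil>"
    and edges: "\<forall>j<n. \<forall>i\<le>Nb. a * \<Delta> \<le> \<bar>x j - bin_edge Nb i\<bar>"
    and M: "\<forall>i<n. cmod (\<alpha> i) \<le> M"
    and choices: "dpm_choices n \<Omega> Nl Nb g Y B"
  shows "dpm_Lambda n \<Omega> Nl Nb Y B \<noteq> {}"
    and "dpm_output n \<Omega> Nl Nb g Y B x' u \<Longrightarrow>
      \<exists>\<sigma>. \<sigma> permutes {..<n} \<and> (\<forall>j<n.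
        \<bar>x j - x' (\<sigma> j)\<bar> \<le> 8 ^ n * (2 * real n) ^ (2 * n - 2) * (4 * real n) / \<mu>
          * srf \<Omega> \<Delta> ^ (2 * n - 2) * (\<epsilon> / \<Omega>) \<and>
        cmod (\<alpha> j - u $ \<sigma> j) \<le>
          (real n * (M * ((64 * \<tau> * real n + 2) ^ n * (real n * (4 * 8 ^ n / \<mu>)))) + 4 ^ n) *
          (2 * real n) ^ (2 * n - 1) * srf \<Omega> \<Delta> ^ (2 * n - 1) * \<epsilon>)"
proof -
  let ?G = "dpm_grid n \<Omega> Nl"
  have "\<forall>l\<in>?G. \<exists>t\<^sub>0. (\<forall>j<n. \<bar>t\<^sub>0 j - x j\<bar> \<le> \<eta> / (pi * l)) \<and>
      aliased_solutions n l (Y l) =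
        {(l, t) | t. \<exists>j<n. \<exists>m::int. t = t\<^sub>0 j + of_int m / l \<and> \<bar>t\<bar> \<le> 1 / 2}"
  proof
    fix l assume l: "l \<in> ?G"
    then have "prony_nodes n (\<lambda>k. g (l * real k)) (Y l)"
      using choices by (simp add: dpm_choices_def)
    then show "\<exists>t\<^sub>0. (\<forall>j<n. \<bar>t\<^sub>0 j - x j\<bar> \<le> \<eta> / (pi * l)) \<and>
        aliased_solutions n l (Y l) =
          {(l, t) | t. \<exists>j<n. \<exists>m::int. t = t\<^sub>0 j + of_int m / l \<and> \<bar>t\<bar> \<le> 1 / 2}"
      by (rule ex_node_representatives[OF l])
  qed
  from bchoice[OF this] obtain t\<^sub>0 where t\<^sub>0: "\<forall>l\<in>?G. (\<forall>j<n. \<bar>t\<^sub>0 l j - x j\<bar> \<le> \<eta> / (pi * l)) \<and>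
      aliased_solutions n l (Y l) =
        {(l, t) | t. \<exists>j<n. \<exists>m::int. t = t\<^sub>0 l j + of_int m / l \<and> \<bar>t\<bar> \<le> 1 / 2}"
    by (rule exE)
  note near = bspec[OF t\<^sub>0, THEN conjunct1, rule_format]
  note aliases = bspec[OF t\<^sub>0, THEN conjunct2]
  have x_range: "x j \<in> {- 1 / 2..1 / 2}" if "j < n" for j
    using x that by blast
  have margin: "\<bar>t\<^sub>0 l j - x j\<bar> \<le> a / 2 * \<Delta>" if "l \<in> ?G" "j < n" for l j
    using near[OF that] node_error_le_bin_margin[OF that(1)] by linarith
  have largest: "largest_bins n Nb (hist_count (\<Union>l\<in>?G. aliased_solutions n l (Y l)) Nb) B"
    using choices by (simp add: dpm_choices_def)
  note select = dpm_selects_true_bins[OF n \<Omega> \<Delta> \<tau> a srf_large Nl Nb x_range sep cluster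
      edges[rule_format] margin aliases largest]
  have bins: "dpm_Lambda n \<Omega> Nl Nb Y B \<noteq> {}"
    by (rule select(1))
  have "\<exists>\<pi>. \<pi> permutes {..<n} \<and> (\<forall>l\<in>?G. \<forall>k<n. \<forall>t\<in>hist_bin Nb (B k).
           (l, t) \<in> aliased_solutions n l (Y l) \<longrightarrow> t = t\<^sub>0 l (\<pi> k))"
    by (rule select(2))
  then obtain \<pi> where \<pi>: "\<pi> permutes {..<n}"
    "\<And>l k t. l \<in> ?G \<Longrightarrow> k < n \<Longrightarrow> t \<in> hist_bin Nb (B k) \<Longrightarrow>
        (l, t) \<in> aliased_solutions n l (Y l) \<Longrightarrow> t = t\<^sub>0 l (\<pi> k)"
    by blast
  show "dpm_Lambda n \<Omega> Nl Nb Y B \<noteq> {}" by (rule bins)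
  assume out: "dpm_output n \<Omega> Nl Nb g Y B x' u"
  define l where "l = Max (dpm_Lambda n \<Omega> Nl Nb Y B)"
  have "0 < n" using n by simp
  then have "dpm_Lambda n \<Omega> Nl Nb Y B \<subseteq> ?G"
    by (auto simp: dpm_Lambda_def)
  moreover have "finite ?G" by (simp add: dpm_grid_def Let_def)
  ultimately have l: "l \<in> ?G"
    unfolding l_def using Max_in[of "dpm_Lambda n \<Omega> Nl Nb Y B"] bins finite_subset by blast
  have x': "x' k = t\<^sub>0 l (\<pi> k)" if "k < n" for k
    using out that l by (intro \<pi>(2)) (auto simp: dpm_output_def l_def Let_def)
  have u: "least_squares_solution
          (mat n n (\<lambda>(k, j). exp (2 * of_real pi * \<i> * of_real (x' j) * of_nat k * of_real l)))
          (vec n (\<lambda>k. g (l * real k))) u"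
    using out by (auto simp: dpm_output_def l_def Let_def)
  define \<sigma> where "\<sigma> = inv_into UNIV \<pi>"
  have \<sigma>: "\<sigma> permutes {..<n}"
    unfolding \<sigma>_def by (rule permutes_inv[OF \<pi>(1)])
  have "x' (\<sigma> j) = t\<^sub>0 l j" if "j < n" for j
    using x'[of "\<sigma> j"] permutes_in_image[OF \<sigma>, of j] permutes_inverses(1)[OF \<pi>(1), of j] that
    by (simp add: \<sigma>_def)
  then have err: "\<bar>x' (\<sigma> j) - x j\<bar> \<le> \<eta> / (pi * l)" if "j < n" for j
    using near[OF l that] that by simp
  show "\<exists>\<sigma>. \<sigma> permutes {..<n} \<and> (\<forall>j<n.
        \<bar>x j - x' (\<sigma> j)\<bar> \<le> 8 ^ n * (2 * real n) ^ (2 * n - 2) * (4 * real n) / \<mu>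
          * srf \<Omega> \<Delta> ^ (2 * n - 2) * (\<epsilon> / \<Omega>) \<and>
        cmod (\<alpha> j - u $ \<sigma> j) \<le>
          (real n * (M * ((64 * \<tau> * real n + 2) ^ n * (real n * (4 * 8 ^ n / \<mu>)))) + 4 ^ n) *
          (2 * real n) ^ (2 * n - 1) * srf \<Omega> \<Delta> ^ (2 * n - 1) * \<epsilon>)"
  proof (intro exI[of _ \<sigma>] conjI \<sigma> allI impI)
    fix j assume j: "j < n"
    show "\<bar>x j - x' (\<sigma> j)\<bar> \<le> 8 ^ n * (2 * real n) ^ (2 * n - 2) * (4 * real n) / \<mu>
          * srf \<Omega> \<Delta> ^ (2 * n - 2) * (\<epsilon> / \<Omega>)"
      using err[OF j] node_error_le[OF l] by (simp only: abs_minus_commute[of "x j"])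
    show "cmod (\<alpha> j - u $ \<sigma> j) \<le>
          (real n * (M * ((64 * \<tau> * real n + 2) ^ n * (real n * (4 * 8 ^ n / \<mu>)))) + 4 ^ n) *
          (2 * real n) ^ (2 * n - 1) * srf \<Omega> \<Delta> ^ (2 * n - 1) * \<epsilon>"
      by (rule amplitude_estimate_error[OF l err \<sigma> u M[rule_format] j])
  qed
qed

end

theorem theorem3:
  fixes n :: nat and \<tau> m\<^sub>\<alpha> M\<^sub>\<alpha> a :: real
  assumes "2 \<le> n" and "0 < \<tau>" and "0 < m\<^sub>\<alpha>" and "m\<^sub>\<alpha> \<le> M\<^sub>\<alpha>"
    and "0 < a" and "a < min (1 / 6) \<tau>"
  shows "\<exists>C\<^sub>0 c\<^sub>0 C\<^sub>1 C :: real. 0 < C\<^sub>0 \<and> 0 < c\<^sub>0 \<and> 0 < C\<^sub>1 \<and> 0 < C \<and>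
    (\<forall>(\<Omega>::real) (x :: nat \<Rightarrow> real) (\<alpha> :: nat \<Rightarrow> complex) (\<epsilon>::real)
       (e :: real \<Rightarrow> complex) (g :: real \<Rightarrow> complex) (\<Delta>::real) (N\<^sub>l::nat) (N\<^sub>b::nat).
      0 < \<Omega> \<longrightarrow>
      x ` {..<n} \<subseteq> {- 1 / 2 .. 1 / 2} \<longrightarrow>
      inj_on x {..<n} \<longrightarrow>
      \<Delta> = min_separation n x \<longrightarrow>
      N\<^sub>l = nat \<lceil>C\<^sub>1 * \<Omega>\<rceil> \<longrightarrow>
      N\<^sub>b = nat \<lceil>3 / \<Delta>\<rceil> \<longrightarrow>
      (\<forall>s<n. \<forall>k<n. \<bar>x s - x k\<bar> \<le> 2 * \<tau> * \<Delta>) \<longrightarrow>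
      (\<forall>k<n. m\<^sub>\<alpha> \<le> cmod (\<alpha> k) \<and> cmod (\<alpha> k) \<le> M\<^sub>\<alpha>) \<longrightarrow>
      C\<^sub>0 \<le> srf \<Omega> \<Delta> \<longrightarrow>
      0 < \<epsilon> \<longrightarrow> \<epsilon> \<le> c\<^sub>0 * (\<Omega> * \<Delta>) ^ (2 * n - 1) \<longrightarrow>
      (\<forall>j<n. \<forall>i\<le>N\<^sub>b. a * \<Delta> \<le> \<bar>x j - bin_edge N\<^sub>b i\<bar>) \<longrightarrow>
      (\<forall>\<omega> \<in> {- \<Omega> .. \<Omega>}. cmod (e \<omega>) \<le> \<epsilon>) \<longrightarrow>
      (\<forall>\<omega> \<in> {- \<Omega> .. \<Omega>}.
         g \<omega> = (\<Sum>k<n. \<alpha> k * exp (2 * of_real pi * \<i> * of_real (x k) * of_real \<omega>)) + e \<omega>) \<longrightarrow>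
      (\<forall>Y B. dpm_choices n \<Omega> N\<^sub>l N\<^sub>b g Y B \<longrightarrow>
         dpm_Lambda n \<Omega> N\<^sub>l N\<^sub>b Y B \<noteq> {} \<and>
         (\<forall>x' \<alpha>'. dpm_output n \<Omega> N\<^sub>l N\<^sub>b g Y B x' \<alpha>' \<longrightarrow>
            (\<exists>\<sigma>. \<sigma> permutes {..<n} \<and>
              (\<forall>j<n.
                 \<bar>x j - x' (\<sigma> j)\<bar> \<le> C * srf \<Omega> \<Delta> ^ (2 * n - 2) * (\<epsilon> / \<Omega>) \<and>
                 cmod (\<alpha> j - \<alpha>' $ \<sigma> j) \<le> C * srf \<Omega> \<Delta> ^ (2 * n - 1) * \<epsilon>)))))"
proof -
  \<comment> \<open>\<open>A\<^sub>x\<close> and \<open>A\<^sub>\<alpha>\<close> are the constants of the node and amplitude estimates; their sum serves for both.\<close>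
  define A\<^sub>x where "A\<^sub>x = 8 ^ n * (2 * real n) ^ (2 * n - 2) * (4 * real n) / m\<^sub>\<alpha>"
  define A\<^sub>\<alpha> where "A\<^sub>\<alpha> =
    (real n * (M\<^sub>\<alpha> * ((64 * \<tau> * real n + 2) ^ n * (real n * (4 * 8 ^ n / m\<^sub>\<alpha>)))) + 4 ^ n) *
      (2 * real n) ^ (2 * n - 1)"
  define c\<^sub>0 where "c\<^sub>0 = m\<^sub>\<alpha> * (a / 2) / (16 ^ n * (2 * real n) ^ (2 * n - 1))"
  have A_pos: "0 < A\<^sub>x" "0 \<le> A\<^sub>\<alpha>"
    using assms by (auto simp: A\<^sub>x_def A\<^sub>\<alpha>_def intro!: mult_nonneg_nonneg add_nonneg_nonneg)
  show ?thesis
  proof (rule exI[of _ "16 + 6 * \<tau>"], rule exI[of _ c\<^sub>0], rule exI[of _ 7],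
      rule exI[of _ "A\<^sub>x + A\<^sub>\<alpha>"], intro conjI allI impI)
    show "0 < 16 + 6 * \<tau>" "0 < c\<^sub>0" "(0::real) < 7" "0 < A\<^sub>x + A\<^sub>\<alpha>"
      using assms A_pos by (auto simp: c\<^sub>0_def)
  next
    fix \<Omega> :: real and x :: "nat \<Rightarrow> real" and \<alpha> :: "nat \<Rightarrow> complex" and \<epsilon> :: real
      and e g :: "real \<Rightarrow> complex" and \<Delta> :: real and N\<^sub>l N\<^sub>b :: nat
      and Y :: "real \<Rightarrow> nat \<Rightarrow> real" and B :: "nat \<Rightarrow> nat"
    assume \<Omega>: "0 < \<Omega>" and x: "x ` {..<n} \<subseteq> {- 1 / 2..1 / 2}" "inj_on x {..<n}"
      and \<Delta>: "\<Delta> = min_separation n x"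
      and N: "N\<^sub>l = nat \<lceil>7 * \<Omega>\<rceil>" "N\<^sub>b = nat \<lceil>3 / \<Delta>\<rceil>"
      and cluster: "\<forall>s<n. \<forall>k<n. \<bar>x s - x k\<bar> \<le> 2 * \<tau> * \<Delta>"
      and \<alpha>: "\<forall>k<n. m\<^sub>\<alpha> \<le> cmod (\<alpha> k) \<and> cmod (\<alpha> k) \<le> M\<^sub>\<alpha>"
      and srf: "16 + 6 * \<tau> \<le> srf \<Omega> \<Delta>"
      and \<epsilon>: "0 < \<epsilon>" "\<epsilon> \<le> c\<^sub>0 * (\<Omega> * \<Delta>) ^ (2 * n - 1)"
      and edges: "\<forall>j<n. \<forall>i\<le>N\<^sub>b. a * \<Delta> \<le> \<bar>x j - bin_edge N\<^sub>b i\<bar>"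
      and e: "\<forall>\<omega>\<in>{- \<Omega>..\<Omega>}. cmod (e \<omega>) \<le> \<epsilon>"
      and g: "\<forall>\<omega>\<in>{- \<Omega>..\<Omega>}.
        g \<omega> = (\<Sum>k<n. \<alpha> k * exp (2 * of_real pi * \<i> * of_real (x k) * of_real \<omega>)) + e \<omega>"
      and choices: "dpm_choices n \<Omega> N\<^sub>l N\<^sub>b g Y B"
    have \<Delta>_pos: "0 < \<Delta>"
      unfolding \<Delta> by (rule min_separation[OF assms(1) x(2)])
    have srf': "\<Omega> * \<Delta> * (16 + 6 * \<tau>) \<le> 1"
      using srf \<Omega> \<Delta>_pos by (simp add: srf_def pos_le_divide_eq mult.commute)
    interpret cluster_problem n \<Omega> \<Delta> \<tau> a m\<^sub>\<alpha> \<epsilon> x \<alpha> e g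
    proof
      show "\<Delta> \<le> \<bar>x i - x k\<bar>" if "i < n" "k < n" "i \<noteq> k" for i k
        unfolding \<Delta> using min_separation(2)[OF assms(1) x(2) that] .
    qed (use assms \<Omega> \<Delta>_pos srf' \<epsilon> cluster \<alpha> e g in \<open>auto simp: c\<^sub>0_def\<close>)
    have M: "\<forall>i<n. cmod (\<alpha> i) \<le> M\<^sub>\<alpha>"
      using \<alpha> by blast
    note recovers = dpm_recovers[OF x(1) N edges M choices]
    show "dpm_Lambda n \<Omega> N\<^sub>l N\<^sub>b Y B \<noteq> {}"
      by (rule recovers(1))
    fix x' :: "nat \<Rightarrow> real" and \<alpha>' :: "complex vec"
    assume "dpm_output n \<Omega> N\<^sub>l N\<^sub>b g Y B x' \<alpha>'"
    from recovers(2)[OF this] obtain \<sigma> where \<sigma>: "\<sigma> permutes {..<n}"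
      "\<And>j. j < n \<Longrightarrow> \<bar>x j - x' (\<sigma> j)\<bar> \<le> A\<^sub>x * srf \<Omega> \<Delta> ^ (2 * n - 2) * (\<epsilon> / \<Omega>)"
      "\<And>j. j < n \<Longrightarrow> cmod (\<alpha> j - \<alpha>' $ \<sigma> j) \<le> A\<^sub>\<alpha> * srf \<Omega> \<Delta> ^ (2 * n - 1) * \<epsilon>"
      unfolding A\<^sub>x_def A\<^sub>\<alpha>_def by blast
    have "0 \<le> srf \<Omega> \<Delta>"
      using \<Omega> \<Delta>_pos by (simp add: srf_def)
    then have weaken: "A\<^sub>x * srf \<Omega> \<Delta> ^ (2 * n - 2) * (\<epsilon> / \<Omega>) \<le> (A\<^sub>x + A\<^sub>\<alpha>) * srf \<Omega> \<Delta> ^ (2 * n - 2) * (\<epsilon> / \<Omega>)"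
      "A\<^sub>\<alpha> * srf \<Omega> \<Delta> ^ (2 * n - 1) * \<epsilon> \<le> (A\<^sub>x + A\<^sub>\<alpha>) * srf \<Omega> \<Delta> ^ (2 * n - 1) * \<epsilon>"
      using A_pos \<epsilon>(1) \<Omega> by (auto intro!: mult_right_mono divide_right_mono)
    show "\<exists>\<sigma>. \<sigma> permutes {..<n} \<and>
        (\<forall>j<n. \<bar>x j - x' (\<sigma> j)\<bar> \<le> (A\<^sub>x + A\<^sub>\<alpha>) * srf \<Omega> \<Delta> ^ (2 * n - 2) * (\<epsilon> / \<Omega>) \<and>
               cmod (\<alpha> j - \<alpha>' $ \<sigma> j) \<le> (A\<^sub>x + A\<^sub>\<alpha>) * srf \<Omega> \<Delta> ^ (2 * n - 1) * \<epsilon>)"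
      using order.trans[OF \<sigma>(2) weaken(1)] order.trans[OF \<sigma>(3) weaken(2)]
      by (intro exI[of _ \<sigma>] conjI \<sigma>(1)) simp
  qed
qed

end
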